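(* Let $\{(A_n,p_n)\}_{n\in\mathbb{N}}$ be a rare-events source with limit distribution $P$, let $\phi_n=\{\phi_{n,k}\}_{k\in\mathbb{N}_0}$ be the Good-Turing estimator computed from $X_{n,1},\dots,X_{n,n}$, and let $\tilde P_n^{\mathrm{ML}}$ be the maximum likelihood estimator of the mixing distribution, i.e. a probability measure on $\mathbb{R}^+$ with $$\tilde P_n^{\mathrm{ML}}\in\operatorname*{argmax}_{Q}\ \sum_{k=0}^\infty\phi_{n,k}\log\left(\int_0^\infty\frac{x^ke^{-x}}{k!}\,\mathrm{d}Q(x)\right),$$ where $Q$ ranges over the probability measures on $\mathbb{R}^+$. Then, for almost every sample sequence, $\{\tilde P_n^{\mathrm{ML}}\}$ converges weakly to $P$ as $n\to\infty$.
   Context: Rare-events source: a sequence $\{(A_n,p_n)\}_{n\in\mathbb{N}}$, where $A_n$ is a finite alphabet and $p_n$ a probability mass function on $A_n$, such that, with $X_n\sim p_n$, $Z_n=n\,p_n(X_n)$ and $P_n$ the distribution of $Z_n$: (i) there is an interval $C=[\check c,\hat c]$ with $0<\check c\le\hat c<\infty$ such that $\check c/n\le p_n(a)\le\hat c/n$ for all $n$ and all $a\in A_n$; (ii) there is a probability distribution $P$ with $P_n\Rightarrow P$ weakly (so $P$ is supported on $C$). Sampling: for each $n$, $X_{n,1},\dots,X_{n,n}$ are i.i.d. from $p_n$; all samples live on a common probability space. Good-Turing estimator: let $\varphi_{n,k}$ be the number of symbols of $A_n$ that appear exactly $k$ times in $X_{n,1},\dots,X_{n,n}$; then $\phi_{n,k}=\frac{(k+1)\varphi_{n,k+1}}{n}$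 for $k\in\mathbb{N}_0$ (a random probability mass function on $\mathbb{N}_0$ with finite support). Conventions: $\mathbb{R}^+=[0,\infty)$, $0^0=1$, and $0\cdot\log 0=0$. The existence and uniqueness of the maximizer is a known result of Simar on Poisson mixtures, and is taken as given. *)

theory Defs
  imports "HOL-Probability.Probability"
begin

text \<open>All sequences are indexed by \<open>n \<ge> 1\<close>; the entries at \<open>n = 0\<close> are left unconstrained
  and play no role in the limits.\<close>

text \<open>The bounds on \<open>pmf (p n)\<close> hold on all of \<open>A n\<close>, so \<open>A n\<close> is exactly the support
  of \<open>p n\<close>. The measure in the last conjunct is the distribution of \<open>n p\<^sub>n(X\<^sub>n)\<close>
  with \<open>X\<^sub>n \<sim> p\<^sub>n\<close>.\<close>

definition rare_events_source ::
  "(nat \<Rightarrow> 'a set) \<Rightarrow> (nat \<Rightarrow> 'a pmf) \<Rightarrow> real measure \<Rightarrow> bool" where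
  "rare_events_source A p P \<longleftrightarrow>
     (\<forall>n\<ge>1. finite (A n) \<and> set_pmf (p n) \<subseteq> A n) \<and>
     (\<exists>c d. 0 < c \<and> c \<le> d \<and>
        (\<forall>n\<ge>1. \<forall>a\<in>A n. c / real n \<le> pmf (p n) a \<and> pmf (p n) a \<le> d / real n)) \<and>
     real_distribution P \<and>
     weak_conv_m (\<lambda>n. distr (measure_pmf (p n)) borel (\<lambda>a. real n * pmf (p n) a)) P"

text \<open>No joint law is imposed across different values of \<open>n\<close>.\<close>

definition iid_samples ::
  "'w measure \<Rightarrow> (nat \<Rightarrow> 'a pmf) \<Rightarrow> (nat \<Rightarrow> nat \<Rightarrow> 'w \<Rightarrow> 'a) \<Rightarrow> bool" where
  "iid_samples M p X \<longleftrightarrow>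
     (\<forall>n\<ge>1. prob_space.indep_vars M (\<lambda>_. count_space UNIV) (X n) {1..n} \<and>
        (\<forall>i\<in>{1..n}. distr M (count_space UNIV) (X n i) = measure_pmf (p n)))"

definition prevalence :: "'a set \<Rightarrow> nat \<Rightarrow> (nat \<Rightarrow> 'a) \<Rightarrow> nat \<Rightarrow> nat" where
  "prevalence A n x k = card {a \<in> A. card {i \<in> {1..n}. x i = a} = k}"

definition good_turing :: "'a set \<Rightarrow> nat \<Rightarrow> (nat \<Rightarrow> 'a) \<Rightarrow> nat \<Rightarrow> real" where
  "good_turing A n x k = real (k + 1) * real (prevalence A n x (k + 1)) / real n"

definition prob_on_nonneg :: "real measure \<Rightarrow> bool" where
  "prob_on_nonneg Q \<longleftrightarrow> real_distribution Q \<and> measure Q {0..} = 1"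

definition poisson_mixture :: "real measure \<Rightarrow> nat \<Rightarrow> real" where
  "poisson_mixture Q k = (LINT x:{0..}|Q. x ^ k * exp (- x) / fact k)"

text \<open>The logarithm with \<open>log 0 = -\<infinity>\<close>. The library's \<open>ln 0 = 0\<close> would make the point
  mass at 0, whose Poisson mixture vanishes for \<open>k \<ge> 1\<close>, a spurious maximizer. In \<open>ereal\<close>,
  \<open>0 * (-\<infinity>) = 0\<close>, which is the convention \<open>0 log 0 = 0\<close>.\<close>

definition log_ext :: "real \<Rightarrow> ereal" where
  "log_ext x = (if x \<le> 0 then -\<infinity> else ereal (ln x))"

definition mixture_log_likelihood :: "(nat \<Rightarrow> real) \<Rightarrow> real measure \<Rightarrow> ereal" where
  "mixture_log_likelihood \<phi> Q = (\<Sum>k. ereal (\<phi> k) * log_ext (poisson_mixture Q k))"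

definition is_mixing_MLE :: "(nat \<Rightarrow> real) \<Rightarrow> real measure \<Rightarrow> bool" where
  "is_mixing_MLE \<phi> Q \<longleftrightarrow> is_arg_max (mixture_log_likelihood \<phi>) prob_on_nonneg Q"

end

theory Submission
  imports Defs
begin

text \<open>The Good-Turing estimates \<open>\<phi>\<^sub>n\<^sub>,\<^sub>k\<close> converge almost surely to the coefficients \<open>\<pi>\<^sub>k\<close> of the
  Poisson mixture of \<open>P\<close>: their expectations converge by the Poisson limit of the binomial
  distribution, and McDiarmid's inequality makes the deviations summable, so that no joint law
  across \<open>n\<close> is needed.

  For the coefficients \<open>q\<^sub>n\<^sub>,\<^sub>k\<close> of the maximizer, no control of the tail of the log-likelihood is
  needed. First-order optimality against \<open>P\<close> gives \<open>\<Sum>\<^sub>k \<phi>\<^sub>n\<^sub>,\<^sub>k \<pi>\<^sub>k / q\<^sub>n\<^sub>,\<^sub>k \<le> 1\<close>, and the equality case of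
  the Cauchy-Schwarz inequality forces \<open>q\<^sub>n\<^sub>,\<^sub>k \<longlonglongrightarrow> \<pi>\<^sub>k\<close> for every \<open>k\<close>. Since \<open>P\<close> has compact support,
  convergence of all moments of \<open>exp (- x) dQ\<^sub>n\<close> implies weak convergence.\<close>

subsection \<open>Concentration for functions of independent variables\<close>

lemma expectation_bind_pmf:
  fixes f :: "'b \<Rightarrow> real"
  assumes "\<And>x. \<bar>f x\<bar> \<le> B"
  shows "measure_pmf.expectation (p \<bind> K) f
       = measure_pmf.expectation p (\<lambda>x. measure_pmf.expectation (K x) f)"
  unfolding measure_pmf_bind
  by (rule integral_bind[where K = "count_space UNIV" and B = B and B' = 1])
     (use assms measurable_measure_pmf[of K] in \<open>simp_all add: measure_pmf.finite_measure_axioms\<close>)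

lemma integrable_measure_pmf_bounded:
  fixes f :: "'a \<Rightarrow> real"
  assumes "\<And>x. \<bar>f x\<bar> \<le> B"
  shows "integrable (measure_pmf p) f"
  by (rule measure_pmf.integrable_const_bound[where B = B]) (use assms in auto)

lemma abs_expectation_pmf_le:
  fixes f :: "'a \<Rightarrow> real"
  assumes "\<And>x. \<bar>f x\<bar> \<le> B"
  shows "\<bar>measure_pmf.expectation p f\<bar> \<le> B"
proof -
  have "\<bar>measure_pmf.expectation p f\<bar> \<le> measure_pmf.expectation p (\<lambda>x. \<bar>f x\<bar>)"
    by (rule integral_abs_bound)
  also have "\<dots> \<le> measure_pmf.expectation p (\<lambda>_. B)"
    by (intro integral_mono integrable_measure_pmf_bounded[where B = B]) (use assms order.trans[OF abs_ge_zero assms] in auto)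
  finally show ?thesis by simp
qed

text \<open>Oscillation at most \<open>c\<close> confines \<open>f\<close> to an interval of length
  \<open>2 * c\<close> around its value at an arbitrary reference point. This avoids the extrema of
  \<open>f\<close> and costs only a factor 4 in the exponent of Hoeffding's lemma.\<close>

lemma Hoeffding_pmf:
  fixes f :: "'a \<Rightarrow> real"
  assumes osc: "\<And>x y. \<bar>f x - f y\<bar> \<le> c" and "s > 0"
  shows "(\<integral>\<^sup>+x. exp (s * (f x - measure_pmf.expectation p f)) \<partial>measure_pmf p) \<le> exp (s\<^sup>2 * c\<^sup>2 / 2)"
proof -
  define x0 :: 'a where "x0 = undefined"
  interpret interval_bounded_random_variable "measure_pmf p" f "f x0 - c" "f x0 + c"
  proof unfold_locales
    have "f x \<in> {f x0 - c..f x0 + c}" for x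
      using osc[of x x0] by (auto simp: abs_le_iff)
    thus "AE x in measure_pmf p. f x \<in> {f x0 - c..f x0 + c}" by simp
  qed auto
  have eq: "s\<^sup>2 * (f x0 + c - (f x0 - c))\<^sup>2 / 8 = s\<^sup>2 * c\<^sup>2 / 2"
    by (simp add: power2_eq_square)
  show ?thesis
    using Hoeffdings_lemma_nn_integral[OF \<open>s > 0\<close>] by (simp only: eq)
qed

text \<open>Induction on the coordinates. \<open>G y\<close> is the conditional expectation given
  that coordinate \<open>i\<close> equals \<open>y\<close>. The deviation of \<open>f\<close> splits
  into \<open>F y x - G y\<close>, controlled by the induction hypothesis uniformly in
  \<open>y\<close>, and the deviation of \<open>G\<close>, controlled by Hoeffding's lemma.\<close>

lemma McDiarmid_mgf:
  fixes f :: "('i \<Rightarrow> 'a) \<Rightarrow> real"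
  assumes "finite I" and "s > 0"
    and "\<And>x. \<bar>f x\<bar> \<le> B"
    and "\<And>x i y. i \<in> I \<Longrightarrow> \<bar>f (x(i := y)) - f x\<bar> \<le> c"
  shows "(\<integral>\<^sup>+x. exp (s * (f x - measure_pmf.expectation (Pi_pmf I d p) f)) \<partial>measure_pmf (Pi_pmf I d p))
          \<le> exp (real (card I) * (s\<^sup>2 * (2 * c)\<^sup>2 / 2))"
  using assms(1,3,4)
proof (induction I arbitrary: f rule: finite_induct)
  case empty
  then show ?case by simp
next
  case (insert i I)
  define R where "R = Pi_pmf I d p"
  define F where "F = (\<lambda>y x. f (x(i := y)))"
  define G where "G = (\<lambda>y. measure_pmf.expectation R (F y))"
  have R: "Pi_pmf (insert i I) d p = p i \<bind> (\<lambda>y. map_pmf (\<lambda>x. x(i := y)) R)"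
    using insert.hyps by (simp add: Pi_pmf_insert' R_def map_pmf_def)
  have Ef: "measure_pmf.expectation (Pi_pmf (insert i I) d p) f = measure_pmf.expectation (p i) G"
    unfolding R by (subst expectation_bind_pmf[where B = B])
                   (use insert.prems in \<open>auto simp: G_def F_def\<close>)
  have Fint: "integrable (measure_pmf R) (F y)" for y
    by (rule integrable_measure_pmf_bounded[where B = B]) (use insert.prems in \<open>auto simp: F_def\<close>)
  \<comment> \<open>The two values of the coordinate are compared through the unmodified
    \<open>x\<close>, hence \<open>2 * c\<close>. Only an exponential rate is wanted later, so the
    constant does not matter.\<close>
  have osc: "\<bar>G y - G y'\<bar> \<le> 2 * c" for y y'
  proof -
    have "\<bar>F y x - F y' x\<bar> \<le> 2 * c" for x
      using insert.prems(2)[of i x y] insert.prems(2)[of i x y'] by (simp add: F_def del: fun_upd_apply)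
    from abs_expectation_pmf_le[of "\<lambda>x. F y x - F y' x", OF this, of R] show ?thesis
      by (simp add: G_def Bochner_Integration.integral_diff[OF Fint Fint])
  qed
  have IH: "(\<integral>\<^sup>+x. exp (s * (F y x - G y)) \<partial>measure_pmf R) \<le> exp (real (card I) * (s\<^sup>2 * (2 * c)\<^sup>2 / 2))" for y
    unfolding G_def R_def
  proof (rule insert.IH)
    show "\<bar>F y x\<bar> \<le> B" for x using insert.prems by (auto simp: F_def)
    show "\<bar>F y (x(j := z)) - F y x\<bar> \<le> c" if "j \<in> I" for x j z
    proof -
      have "j \<noteq> i" using that insert.hyps by auto
      with insert.prems(2)[of j "x(i := y)" z] that show ?thesis
        by (simp add: F_def fun_upd_twist del: fun_upd_apply)
    qed
  qed
  have "(\<integral>\<^sup>+x. exp (s * (f x - measure_pmf.expectation (Pi_pmf (insert i I) d p) f))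
            \<partial>measure_pmf (Pi_pmf (insert i I) d p))
      = (\<integral>\<^sup>+x. exp (s * (f x - measure_pmf.expectation (p i) G)) \<partial>measure_pmf (Pi_pmf (insert i I) d p))"
    by (simp only: Ef)
  also have "\<dots> = (\<integral>\<^sup>+y. \<integral>\<^sup>+x. ennreal (exp (s * (G y - measure_pmf.expectation (p i) G)))
            * ennreal (exp (s * (F y x - G y))) \<partial>measure_pmf R \<partial>measure_pmf (p i))"
    unfolding R nn_integral_bind_pmf nn_integral_map_pmf
    by (intro nn_integral_cong)
       (simp add: F_def algebra_simps flip: ennreal_mult exp_add)
  also have "\<dots> = (\<integral>\<^sup>+y. ennreal (exp (s * (G y - measure_pmf.expectation (p i) G)))
            * (\<integral>\<^sup>+x. ennreal (exp (s * (F y x - G y))) \<partial>measure_pmf R) \<partial>measure_pmf (p i))"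
    by (simp add: nn_integral_cmult)
  also have "\<dots> \<le> (\<integral>\<^sup>+y. ennreal (exp (s * (G y - measure_pmf.expectation (p i) G)))
            * ennreal (exp (real (card I) * (s\<^sup>2 * (2 * c)\<^sup>2 / 2))) \<partial>measure_pmf (p i))"
    by (intro nn_integral_mono mult_left_mono IH) auto
  also have "\<dots> = (\<integral>\<^sup>+y. ennreal (exp (s * (G y - measure_pmf.expectation (p i) G))) \<partial>measure_pmf (p i))
            * ennreal (exp (real (card I) * (s\<^sup>2 * (2 * c)\<^sup>2 / 2)))"
    by (simp add: nn_integral_multc)
  also have "\<dots> \<le> ennreal (exp (s\<^sup>2 * (2 * c)\<^sup>2 / 2))
            * ennreal (exp (real (card I) * (s\<^sup>2 * (2 * c)\<^sup>2 / 2)))"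
    by (intro mult_right_mono Hoeffding_pmf osc \<open>s > 0\<close>) auto
  also have "\<dots> = exp (real (card (insert i I)) * (s\<^sup>2 * (2 * c)\<^sup>2 / 2))"
    using insert.hyps by (simp add: algebra_simps flip: ennreal_mult exp_add)
  finally show ?case .
qed

lemma McDiarmid_upper:
  fixes f :: "('i \<Rightarrow> 'a) \<Rightarrow> real"
  assumes "finite I" "I \<noteq> {}" "c > 0" "\<epsilon> > 0"
    and "\<And>x. \<bar>f x\<bar> \<le> B"
    and "\<And>x i y. i \<in> I \<Longrightarrow> \<bar>f (x(i := y)) - f x\<bar> \<le> c"
  shows "measure_pmf.prob (Pi_pmf I d p) {x. f x - measure_pmf.expectation (Pi_pmf I d p) f \<ge> \<epsilon>}
          \<le> exp (- \<epsilon>\<^sup>2 / (8 * real (card I) * c\<^sup>2))"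
proof -
  define R where "R = Pi_pmf I d p"
  define N where "N = real (card I)"
  \<comment> \<open>This \<open>s\<close> minimizes the Chernoff exponent
    \<open>- s * \<epsilon> + 2 * N * s\<^sup>2 * c\<^sup>2\<close>.\<close>
  define s where "s = \<epsilon> / (4 * N * c\<^sup>2)"
  have "N > 0" using assms by (simp add: N_def card_gt_0_iff)
  hence "s > 0" using assms by (simp add: s_def)
  have "ennreal (measure_pmf.prob R {x. f x - measure_pmf.expectation R f \<ge> \<epsilon>})
      = emeasure R {x\<in>UNIV. f x - measure_pmf.expectation R f \<ge> \<epsilon>}"
    by (simp add: measure_pmf.emeasure_eq_measure)
  also have "\<dots> \<le> ennreal (exp (- s * \<epsilon>))
      * (\<integral>\<^sup>+x\<in>UNIV. exp (s * (f x - measure_pmf.expectation R f)) \<partial>measure_pmf R)"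
    by (intro Chernoff_ineq_nn_integral_ge \<open>s > 0\<close>) auto
  also have "\<dots> \<le> ennreal (exp (- s * \<epsilon>)) * ennreal (exp (N * (s\<^sup>2 * (2 * c)\<^sup>2 / 2)))"
    using McDiarmid_mgf[OF \<open>finite I\<close> \<open>s > 0\<close> assms(5,6), of d p]
    by (intro mult_left_mono) (auto simp: N_def R_def)
  also have "\<dots> = exp (- s * \<epsilon> + N * (s\<^sup>2 * (2 * c)\<^sup>2 / 2))"
    by (simp flip: ennreal_mult exp_add)
  also have "- s * \<epsilon> + N * (s\<^sup>2 * (2 * c)\<^sup>2 / 2) = - \<epsilon>\<^sup>2 / (8 * N * c\<^sup>2)"
    using \<open>N > 0\<close> \<open>c > 0\<close> by (simp add: s_def field_simps power2_eq_square)
  finally show ?thesis by (simp add: R_def N_def)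
qed

lemma McDiarmid:
  fixes f :: "('i \<Rightarrow> 'a) \<Rightarrow> real"
  assumes "finite I" "I \<noteq> {}" "c > 0" "\<epsilon> > 0"
    and bounded: "\<And>x. \<bar>f x\<bar> \<le> B"
    and diff: "\<And>x i y. i \<in> I \<Longrightarrow> \<bar>f (x(i := y)) - f x\<bar> \<le> c"
  shows "measure_pmf.prob (Pi_pmf I d p) {x. \<bar>f x - measure_pmf.expectation (Pi_pmf I d p) f\<bar> \<ge> \<epsilon>}
          \<le> 2 * exp (- \<epsilon>\<^sup>2 / (8 * real (card I) * c\<^sup>2))"
proof -
  define R where "R = Pi_pmf I d p"
  let ?E = "measure_pmf.expectation R"
  have "{x. \<bar>f x - ?E f\<bar> \<ge> \<epsilon>} = {x. f x - ?E f \<ge> \<epsilon>} \<union> {x. - f x - ?E (\<lambda>x. - f x) \<ge> \<epsilon>}"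
    by auto
  hence "measure_pmf.prob R {x. \<bar>f x - ?E f\<bar> \<ge> \<epsilon>}
      \<le> measure_pmf.prob R {x. f x - ?E f \<ge> \<epsilon>} + measure_pmf.prob R {x. - f x - ?E (\<lambda>x. - f x) \<ge> \<epsilon>}"
    by (simp only:) (rule measure_Un_le; simp)
  also have "\<dots> \<le> exp (- \<epsilon>\<^sup>2 / (8 * real (card I) * c\<^sup>2)) + exp (- \<epsilon>\<^sup>2 / (8 * real (card I) * c\<^sup>2))"
    unfolding R_def
  proof (intro add_mono McDiarmid_upper[where B = B] assms)
    show "\<bar>- f x\<bar> \<le> B" for x using bounded[of x] by simp
    show "\<bar>- f (x(i := y)) - - f x\<bar> \<le> c" if "i \<in> I" for x i y
      using diff[OF that, of x y] by simp
  qed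
  finally show ?thesis by (simp add: R_def)
qed

subsection \<open>The Good-Turing estimator under the product law\<close>

text \<open>The Poisson limit theorem for \<open>n - 1\<close> trials, the number that
  \<open>expectation_good_turing\<close> produces, with success probabilities for which only
  \<open>y n \<longlonglongrightarrow> l\<close> is known.\<close>

lemma binomial_Poisson_limit:
  fixes y :: "nat \<Rightarrow> real"
  assumes y: "y \<longlonglongrightarrow> l" and nonneg: "\<And>n. n \<ge> 1 \<Longrightarrow> y n \<ge> 0"
  shows "(\<lambda>n. real ((n - 1) choose k) * (y n / n) ^ k * (1 - y n / n) ^ (n - 1 - k))
          \<longlonglongrightarrow> l ^ k * exp (- l) / fact k"
proof -
  have inv: "(\<lambda>n. 1 / real n) \<longlonglongrightarrow> 0"
    by (rule lim_1_over_n)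
  have yn: "(\<lambda>n. y n / n) \<longlonglongrightarrow> 0"
    using tendsto_mult[OF y inv] by simp
  have ln0: "(\<lambda>n. l / real n) \<longlonglongrightarrow> 0"
    using tendsto_mult[OF tendsto_const inv, of l] by simp
  have l: "l \<ge> 0"
    by (rule tendsto_lowerbound[OF y]) (auto intro: eventually_sequentiallyI[of 1] nonneg)
  \<comment> \<open>For \<open>a\<close>, \<open>b\<close> of modulus at most 1, the difference of
    the \<open>n\<close>-th powers is at most \<open>n\<close> times that of \<open>a\<close> and
    \<open>b\<close>. The factor \<open>n\<close> cancels and leaves
    \<open>\<bar>y n - l\<bar>\<close>.\<close>
  have "(\<lambda>n. (1 - y n / n) ^ n - (1 + (- l) / n) ^ n) \<longlonglongrightarrow> 0"
  proof (rule Lim_null_comparison)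
    show "(\<lambda>n. \<bar>y n - l\<bar>) \<longlonglongrightarrow> 0"
      using tendsto_rabs[OF LIM_zero[OF y]] by simp
    show "\<forall>\<^sub>F n in sequentially. norm ((1 - y n / n) ^ n - (1 + (- l) / n) ^ n) \<le> \<bar>y n - l\<bar>"
      using order_tendstoD(2)[OF yn zero_less_one] order_tendstoD(2)[OF ln0 zero_less_one]
        eventually_ge_at_top[of 1]
    proof eventually_elim
      case (elim n)
      have "y n / n \<ge> 0" "l / n \<ge> 0" using nonneg[of n] l elim by auto
      hence "norm ((1 - y n / n) ^ n - (1 + (- l) / n) ^ n)
          \<le> n * norm ((1 - y n / n) - (1 + (- l) / n))"
        using elim(1,2) by (intro norm_power_diff) (simp_all only: real_norm_def abs_le_iff minus_divide_left[symmetric], linarith+)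
      also have "(1 - y n / n) - (1 + (- l) / n) = - ((y n - l) / n)"
        by (simp add: diff_divide_distrib)
      also have "n * norm (- ((y n - l) / n)) = \<bar>y n - l\<bar>"
        using elim by simp
      finally show ?case .
    qed
  qed
  from tendsto_add[OF this tendsto_exp_limit_sequentially[of "- l"]]
  have "(\<lambda>n. (1 - y n / n) ^ n) \<longlonglongrightarrow> exp (- l)" by simp
  moreover have "(\<lambda>n. (1 - y n / n) ^ Suc k) \<longlonglongrightarrow> (1 - 0) ^ Suc k"
    by (intro tendsto_intros yn)
  ultimately have "(\<lambda>n. (1 - y n / n) ^ n / (1 - y n / n) ^ Suc k) \<longlonglongrightarrow> exp (- l) / (1 - 0) ^ Suc k"
    by (rule tendsto_divide) simp
  moreover have "(\<lambda>n. y n ^ k) \<longlonglongrightarrow> l ^ k"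
    by (intro tendsto_intros y)
  moreover have "(\<lambda>n. (\<Prod>i<k. 1 - (1 + real i) * (1 / real n)) / fact k) \<longlonglongrightarrow> (\<Prod>i<k. 1 - (1 + real i) * 0) / fact k"
    by (intro tendsto_intros inv) simp
  ultimately have "(\<lambda>n. (\<Prod>i<k. 1 - (1 + real i) * (1 / real n)) / fact k * y n ^ k
        * ((1 - y n / n) ^ n / (1 - y n / n) ^ Suc k))
      \<longlonglongrightarrow> (\<Prod>i<k. 1 - (1 + real i) * 0) / fact k * l ^ k * (exp (- l) / (1 - 0) ^ Suc k)"
    by (intro tendsto_mult)
  \<comment> \<open>For \<open>n \<ge> Suc k\<close> the subtraction \<open>n - 1 - k\<close> does
    not truncate, and \<open>y n / n < 1\<close> keeps the denominator nonzero. The product is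
    (n-1)...(n-k) divided by \<open>n ^ k\<close>.\<close>
  moreover have "\<forall>\<^sub>F n in sequentially.
      (\<Prod>i<k. 1 - (1 + real i) * (1 / real n)) / fact k * y n ^ k
        * ((1 - y n / n) ^ n / (1 - y n / n) ^ Suc k)
      = real ((n - 1) choose k) * (y n / n) ^ k * (1 - y n / n) ^ (n - 1 - k)"
    using order_tendstoD(2)[OF yn zero_less_one] eventually_ge_at_top[of "Suc k"]
  proof eventually_elim
    case (elim n)
    have "real ((n - 1) choose k) = (\<Prod>i = 0..<k. real (n - 1) - real i) / fact k"
      by (simp add: binomial_gbinomial gbinomial_prod_rev)
    also have "(\<Prod>i = 0..<k. real (n - 1) - real i) = (\<Prod>i<k. n * (1 - (1 + real i) * (1 / real n)))"
      using elim by (intro prod.cong) (auto simp: field_simps of_nat_diff)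
    also have "\<dots> = n ^ k * (\<Prod>i<k. 1 - (1 + real i) * (1 / real n))"
      by (subst prod.distrib) simp
    finally have 1: "real ((n - 1) choose k) = n ^ k * (\<Prod>i<k. 1 - (1 + real i) * (1 / real n)) / fact k"
      by simp
    have "n - 1 - k = n - Suc k" by simp
    hence 2: "(1 - y n / n) ^ n / (1 - y n / n) ^ Suc k = (1 - y n / n) ^ (n - 1 - k)"
      using elim by (simp add: power_diff del: power_Suc)
    have "real n \<noteq> 0" using elim by simp
    thus ?case unfolding 1 2 by (simp add: power_divide)
  qed
  ultimately show ?thesis
    by (simp add: tendsto_cong)
qed

lemma map_pmf_count_Pi_pmf:
  assumes "finite I"
  shows "map_pmf (\<lambda>x. card {i\<in>I. x i = a}) (Pi_pmf I d (\<lambda>_. p)) = binomial_pmf (card I) (pmf p a)"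
proof -
  have bern: "map_pmf (\<lambda>b. b = a) p = bernoulli_pmf (pmf p a)"
  proof (rule pmf_eqI)
    fix b
    have T: "pmf (map_pmf (\<lambda>b. b = a) p) True = pmf p a"
      by (simp add: pmf_map vimage_def measure_pmf_single)
    have F: "pmf (map_pmf (\<lambda>b. b = a) p) False = 1 - pmf p a"
      by (metis T pmf_False_conv_True)
    show "pmf (map_pmf (\<lambda>b. b = a) p) b = pmf (bernoulli_pmf (pmf p a)) b"
      by (cases b) (simp_all add: T F pmf_le_1)
  qed
  \<comment> \<open>The default of the Boolean product is \<open>d = a\<close>, the image of
    \<open>d\<close>, as \<open>Pi_pmf_map\<close> requires.\<close>
  have "binomial_pmf (card I) (pmf p a)
      = map_pmf (\<lambda>f. card {i\<in>I. f i}) (Pi_pmf I (d = a) (\<lambda>_. map_pmf (\<lambda>b. b = a) p))"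
    unfolding bern by (rule binomial_pmf_altdef') (use assms in \<open>auto simp: pmf_le_1\<close>)
  also have "\<dots> = map_pmf (\<lambda>x. card {i\<in>I. x i = a}) (Pi_pmf I d (\<lambda>_. p))"
    by (subst Pi_pmf_map[where dflt = d]) (use assms in \<open>simp_all add: pmf.map_comp o_def\<close>)
  finally show ?thesis ..
qed

section \<open>Elementary bounds and the expectation of the Good-Turing estimator\<close>

lemma prevalence_altdef:
  assumes "finite A"
  shows "real (prevalence A n x k) = (\<Sum>a\<in>A. of_bool (card {i\<in>{1..n}. x i = a} = k))"
  using assms by (simp add: prevalence_def sum.If_cases of_bool_def Int_def)

text \<open>Replacing one observation affects only the counts of the old and the new symbol, so at
  most these two enter or leave the set of symbols with count \<open>k\<close>. This supplies the
  bounded difference for \<open>McDiarmid\<close>.\<close>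

lemma prevalence_fun_upd:
  assumes "finite A"
  shows "\<bar>real (prevalence A n (x(i := y)) k) - real (prevalence A n x k)\<bar> \<le> 2"
proof -
  define N where "N = (\<lambda>(x :: nat \<Rightarrow> 'a) a. card {j\<in>{1..n}. x j = a})"
  define S where "S = (\<lambda>x. {a\<in>A. N x a = k})"
  have "N (x(i := y)) a = N x a" if "a \<notin> {x i, y}" for a
    unfolding N_def by (rule arg_cong[where f = card]) (use that in auto)
  hence sub: "S (x(i := y)) \<subseteq> S x \<union> {x i, y}" "S x \<subseteq> S (x(i := y)) \<union> {x i, y}"
    unfolding S_def by auto
  have fin: "finite (S x)" for x using assms by (simp add: S_def)
  have two: "card {x i, y} \<le> 2" by (simp add: card_insert_if)
  have "card (S (x(i := y))) \<le> card (S x) + 2"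
    using card_mono[OF _ sub(1)] card_Un_le[of "S x" "{x i, y}"] two fin by force
  moreover have "card (S x) \<le> card (S (x(i := y))) + 2"
    using card_mono[OF _ sub(2)] card_Un_le[of "S (x(i := y))" "{x i, y}"] two fin by force
  ultimately show ?thesis by (simp add: prevalence_def S_def N_def)
qed

lemma good_turing_fun_upd:
  assumes "finite A"
  shows "\<bar>good_turing A n (x(i := y)) k - good_turing A n x k\<bar> \<le> 2 * real (k + 1) / n"
proof -
  have "good_turing A n (x(i := y)) k - good_turing A n x k
      = real (k + 1) / n * (real (prevalence A n (x(i := y)) (k + 1)) - real (prevalence A n x (k + 1)))"
    by (simp add: good_turing_def field_simps diff_divide_distrib)
  also have "\<bar>\<dots>\<bar> \<le> real (k + 1) / n * 2"
    unfolding abs_mult using prevalence_fun_upd[OF assms, of n x i y "k + 1"]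
    by (intro mult_mono) auto
  finally show ?thesis by (simp add: mult.commute)
qed

lemma good_turing_nonneg: "good_turing A n x k \<ge> 0"
  by (simp add: good_turing_def)

lemma good_turing_le:
  assumes "finite A"
  shows "good_turing A n x k \<le> real (k + 1) * card A / n"
  unfolding good_turing_def prevalence_def
  by (intro divide_right_mono mult_left_mono) (auto intro: card_mono assms)

text \<open>No symbol is counted more than \<open>n\<close> times. Consequently the log-likelihood
  series is a finite sum.\<close>

lemma good_turing_eq_0:
  assumes "k \<ge> n"
  shows "good_turing A n x k = 0"
proof -
  have "card {i\<in>{1..n}. x i = a} \<le> n" for a
    using card_mono[of "{1..n}" "{i\<in>{1..n}. x i = a}"] by (simp del: atLeastAtMost_iff)
  hence "card {i\<in>{1..n}. x i = a} \<noteq> k + 1" for a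
    using assms by (metis Suc_eq_plus1 not_less_eq_eq)
  thus ?thesis by (simp add: good_turing_def prevalence_def)
qed

text \<open>Weighting each multiplicity class by its multiplicity counts the observations, of which
  there are \<open>n\<close>. Equality can fail, since \<open>x\<close> may leave \<open>A\<close>
  and counts above \<open>K\<close> are cut off.\<close>

lemma sum_good_turing_le_1:
  assumes "finite A"
  shows "(\<Sum>k<K. good_turing A n x k) \<le> 1"
proof -
  define N where "N = (\<lambda>a. card {i\<in>{1..n}. x i = a})"
  have "(\<Sum>k<K. real (k + 1) * real (prevalence A n x (k + 1)))
      = (\<Sum>a\<in>A. \<Sum>k<K. real (k + 1) * of_bool (N a = k + 1))"
    unfolding prevalence_altdef[OF assms] N_def sum_distrib_left by (subst sum.swap) simp
  also have "\<dots> \<le> (\<Sum>a\<in>A. real (N a))"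
  proof (rule sum_mono)
    fix a
    \<comment> \<open>Only \<open>k = N a - 1\<close> contributes. For \<open>N a = 0\<close>
      truncated subtraction yields the index 0, and the inner conditional removes that term.\<close>
    have "(\<Sum>k<K. real (k + 1) * of_bool (N a = k + 1)) = (\<Sum>k<K. if k = N a - 1 then (if N a \<ge> 1 then real (N a) else 0) else 0)"
      by (intro sum.cong) auto
    also have "\<dots> \<le> real (N a)" by simp
    finally show "(\<Sum>k<K. real (k + 1) * of_bool (N a = k + 1)) \<le> real (N a)" .
  qed
  also have "(\<Sum>a\<in>A. real (N a)) = card (\<Union>a\<in>A. {i\<in>{1..n}. x i = a})"
    unfolding N_def using assms by (subst card_UN_disjoint) auto
  also have "\<dots> \<le> card {1..n}"
    by (intro of_nat_mono card_mono) auto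
  finally have "(\<Sum>k<K. real (k + 1) * real (prevalence A n x (k + 1))) \<le> n" by simp
  thus ?thesis
    by (cases "n = 0") (auto simp: good_turing_def simp flip: sum_divide_distrib)
qed

text \<open>The absorption identity (\<open>absorb\<close>) exchanges the factor
  \<open>k + 1\<close> for \<open>n\<close>. This leaves the weight \<open>pmf p a\<close> in the
  sum over symbols: the expected estimate is the probability that a symbol drawn from
  \<open>p\<close> occurs \<open>k\<close> times among \<open>n - 1\<close> further draws.\<close>

lemma expectation_good_turing:
  assumes "finite A" "set_pmf p \<subseteq> A" "n \<ge> 1"
  shows "measure_pmf.expectation (Pi_pmf {1..n} d (\<lambda>_. p)) (\<lambda>x. good_turing A n x k)
    = measure_pmf.expectation p
        (\<lambda>a. real ((n - 1) choose k) * pmf p a ^ k * (1 - pmf p a) ^ (n - 1 - k))"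
proof -
  define R where "R = Pi_pmf {1..n} d (\<lambda>_. p)"
  have prob: "measure_pmf.expectation R (\<lambda>x. of_bool (card {i\<in>{1..n}. x i = a} = k + 1))
      = real (n choose (k + 1)) * pmf p a ^ (k + 1) * (1 - pmf p a) ^ (n - (k + 1))" for a
  proof -
    have "measure_pmf.expectation R (\<lambda>x. of_bool (card {i\<in>{1..n}. x i = a} = k + 1) :: real)
        = measure_pmf.expectation (map_pmf (\<lambda>x. card {i\<in>{1..n}. x i = a}) R) (indicator {k + 1})"
      unfolding integral_map_pmf by (rule Bochner_Integration.integral_cong) (auto simp: indicator_def)
    also have "\<dots> = pmf (binomial_pmf n (pmf p a)) (k + 1)"
      unfolding R_def map_pmf_count_Pi_pmf[OF finite_atLeastAtMost] by (simp add: measure_pmf_single)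
    finally show ?thesis by (simp add: pmf_le_1)
  qed
  have absorb: "real (k + 1) * real (n choose (k + 1)) = real n * real ((n - 1) choose k)"
    using Suc_times_binomial_eq[of "n - 1" k] \<open>n \<ge> 1\<close>
    by (metis One_nat_def Suc_diff_le Suc_eq_plus1 diff_Suc_Suc diff_zero mult.commute of_nat_mult)
  have "measure_pmf.expectation R (\<lambda>x. good_turing A n x k)
      = real (k + 1) / n * measure_pmf.expectation R
          (\<lambda>x. \<Sum>a\<in>A. of_bool (card {i\<in>{1..n}. x i = a} = k + 1))"
    by (simp add: good_turing_def prevalence_altdef[OF \<open>finite A\<close>] flip: integral_mult_right_zero)
  also have "measure_pmf.expectation R (\<lambda>x. \<Sum>a\<in>A. of_bool (card {i\<in>{1..n}. x i = a} = k + 1) :: real)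
      = (\<Sum>a\<in>A. measure_pmf.expectation R (\<lambda>x. of_bool (card {i\<in>{1..n}. x i = a} = k + 1)))"
    by (intro Bochner_Integration.integral_sum integrable_measure_pmf_bounded[where B = 1]) auto
  also have "real (k + 1) / n * \<dots>
      = (\<Sum>a\<in>A. real ((n - 1) choose k) * pmf p a ^ k * (1 - pmf p a) ^ (n - 1 - k) * pmf p a)"
    unfolding prob sum_distrib_left
  proof (rule sum.cong[OF refl])
    fix a
    have "real (k + 1) / n * (real (n choose (k + 1)) * pmf p a ^ (k + 1) * (1 - pmf p a) ^ (n - (k + 1)))
        = (real (k + 1) * real (n choose (k + 1))) / n * (pmf p a ^ (k + 1) * (1 - pmf p a) ^ (n - (k + 1)))"
      by simp
    also have "\<dots> = real ((n - 1) choose k) * pmf p a ^ k * (1 - pmf p a) ^ (n - 1 - k) * pmf p a"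
      unfolding absorb using \<open>n \<ge> 1\<close> by simp
    finally show "real (k + 1) / n * (real (n choose (k + 1)) * pmf p a ^ (k + 1) * (1 - pmf p a) ^ (n - (k + 1)))
        = real ((n - 1) choose k) * pmf p a ^ k * (1 - pmf p a) ^ (n - 1 - k) * pmf p a" .
  qed
  also have "\<dots> = measure_pmf.expectation p
        (\<lambda>a. real ((n - 1) choose k) * pmf p a ^ k * (1 - pmf p a) ^ (n - 1 - k))"
    by (rule integral_measure_pmf_real[symmetric]) (use assms in auto)
  finally show ?thesis by (simp add: R_def)
qed

subsection \<open>Almost sure convergence of the Good-Turing estimator\<close>

lemma binomial_term_bounds:
  fixes q :: real
  assumes "0 \<le> q" "q \<le> 1"
  shows "\<bar>real (m choose k) * q ^ k * (1 - q) ^ (m - k)\<bar> \<le> 1"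
proof -
  have "real (m choose k) * q ^ k * (1 - q) ^ (m - k) = pmf (binomial_pmf m q) k"
    using assms by simp
  thus ?thesis by (simp add: pmf_le_1)
qed

text \<open>The integrand varies with \<open>n\<close>, so weak convergence does not apply to it
  directly. Skorohod's representation replaces weak convergence by pointwise convergence; then
  \<open>binomial_Poisson_limit\<close> and dominated convergence apply. The bounds \<open>c\<close>
  and \<open>d\<close> pass to the limit in the same coupling.\<close>

lemma rare_events_source_limit:
  assumes "rare_events_source A p P"
  obtains c d where "0 < c" "c \<le> d" "measure P {c..d} = 1"
    "\<And>k. (\<lambda>n. measure_pmf.expectation (p n)
        (\<lambda>a. real ((n - 1) choose k) * pmf (p n) a ^ k * (1 - pmf (p n) a) ^ (n - 1 - k)))
      \<longlonglongrightarrow> poisson_mixture P k"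
proof -
  define \<mu> where "\<mu> = (\<lambda>n. distr (measure_pmf (p n)) borel (\<lambda>a. real n * pmf (p n) a))"
  have supp: "\<And>n. n \<ge> 1 \<Longrightarrow> set_pmf (p n) \<subseteq> A n"
    and P: "real_distribution P" and conv: "weak_conv_m \<mu> P"
    and "\<exists>c d. 0 < c \<and> c \<le> d \<and>
        (\<forall>n\<ge>1. \<forall>a\<in>A n. c / real n \<le> pmf (p n) a \<and> pmf (p n) a \<le> d / real n)"
    using assms by (simp_all add: rare_events_source_def \<mu>_def)
  then obtain c d where cd: "0 < c" "c \<le> d"
    and bounds: "\<And>n a. n \<ge> 1 \<Longrightarrow> a \<in> A n \<Longrightarrow> c / n \<le> pmf (p n) a \<and> pmf (p n) a \<le> d / n"
    by metis
  interpret P: real_distribution P by fact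
  have \<mu>: "real_distribution (\<mu> n)" for n
    unfolding \<mu>_def real_distribution_def real_distribution_axioms_def
    by (auto intro!: measure_pmf.prob_space_distr)
  from Skorohod[OF \<mu> P conv] show ?thesis
  proof (elim exE conjE)
    fix \<Omega> Y Y'
    assume "prob_space \<Omega>"
      and Y_meas: "\<forall>n. Y n \<in> borel_measurable \<Omega>"
      and Y_distr: "\<forall>n. distr \<Omega> borel (Y n) = \<mu> n"
      and "Y' \<in> measurable \<Omega> lborel" and distr_Y': "distr \<Omega> borel Y' = P"
      and Y_lim: "\<forall>x\<in>space \<Omega>. (\<lambda>n. Y n x) \<longlonglongrightarrow> Y' x"
    note [measurable] = Y_meas[rule_format] and distr_Y = Y_distr[rule_format]
      and lim = Y_lim[rule_format]
    interpret \<Omega>: prob_space \<Omega> by fact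
    have [measurable]: "Y' \<in> borel_measurable \<Omega>"
      using \<open>Y' \<in> measurable \<Omega> lborel\<close> by simp
    \<comment> \<open>The third bound expresses \<open>pmf (p n) a \<le> 1\<close>. It makes
      \<open>Y n x / n\<close> a probability, so that the binomial terms are dominated by 1.\<close>
    have "AE x in \<Omega>. c \<le> Y n x \<and> Y n x \<le> d \<and> Y n x \<le> n" if "n \<ge> 1" for n
    proof -
      have "AE y in \<mu> n. c \<le> y \<and> y \<le> d \<and> y \<le> n"
        unfolding \<mu>_def
      proof (subst AE_distr_iff)
        show "AE a in measure_pmf (p n). c \<le> n * pmf (p n) a \<and> n * pmf (p n) a \<le> d \<and> n * pmf (p n) a \<le> n"
        proof (rule AE_pmfI)
          fix a assume "a \<in> set_pmf (p n)"
          with bounds[OF that, of a] supp[OF that] that pmf_le_1[of "p n" a]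
          show "c \<le> n * pmf (p n) a \<and> n * pmf (p n) a \<le> d \<and> n * pmf (p n) a \<le> n"
            by (auto simp: field_simps)
        qed
      qed auto
      thus ?thesis
        unfolding distr_Y[symmetric] by (subst (asm) AE_distr_iff) auto
    qed
    hence "AE x in \<Omega>. \<forall>n. n \<ge> 1 \<longrightarrow> c \<le> Y n x \<and> Y n x \<le> d \<and> Y n x \<le> n"
      by (simp add: AE_all_countable)
    hence Y: "AE x in \<Omega>. x \<in> space \<Omega> \<and> (\<forall>n. n \<ge> 1 \<longrightarrow> c \<le> Y n x \<and> Y n x \<le> d \<and> Y n x \<le> n)"
      by (auto intro: AE_conjI)
    have "AE x in \<Omega>. Y' x \<in> {c..d}"
      using Y
    proof eventually_elim
      case (elim x)
      show ?case
        using LIMSEQ_le_const[OF lim, of x c] LIMSEQ_le_const2[OF lim, of x d] elim by auto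
    qed
    hence AE_P: "AE x in P. x \<in> {c..d}"
      unfolding distr_Y'[symmetric] by (subst AE_distr_iff) auto
    hence supp_P: "measure P {c..d} = 1"
      by (subst P.prob_eq_1) (auto simp: AE_P)
    have "(\<lambda>n. measure_pmf.expectation (p n)
          (\<lambda>a. real ((n - 1) choose k) * pmf (p n) a ^ k * (1 - pmf (p n) a) ^ (n - 1 - k)))
        \<longlonglongrightarrow> poisson_mixture P k" for k
    proof -
      define h where "h = (\<lambda>n z. real ((n - 1) choose k) * (z / real n) ^ k * (1 - z / real n) ^ (n - 1 - k))"
      have [measurable]: "h n \<in> borel_measurable borel" for n
        unfolding h_def by measurable
      have "(\<lambda>n. \<integral>x. h n (Y n x) \<partial>\<Omega>) \<longlonglongrightarrow> (\<integral>x. Y' x ^ k * exp (- Y' x) / fact k \<partial>\<Omega>)"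
      proof (rule integral_dominated_convergence[where w = "\<lambda>_. 1"])
        show "AE x in \<Omega>. (\<lambda>n. h n (Y n x)) \<longlonglongrightarrow> Y' x ^ k * exp (- Y' x) / fact k"
          using Y
        proof eventually_elim
          case (elim x)
          show ?case unfolding h_def
            by (rule binomial_Poisson_limit) (use elim lim cd in \<open>auto intro: order.trans[of 0 c]\<close>)
        qed
        show "AE x in \<Omega>. norm (h n (Y n x)) \<le> 1" for n
          using Y
        proof eventually_elim
          case (elim x)
          have "0 \<le> Y n x / n \<and> Y n x / n \<le> 1"
          proof (cases "n = 0")
            case False
            with elim have "c \<le> Y n x" "Y n x \<le> n" by auto
            with False cd show ?thesis by simp
          qed simp
          thus ?case unfolding h_def real_norm_def by (intro binomial_term_bounds) auto
        qed
      qed auto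
      also have "(\<lambda>n. \<integral>x. h n (Y n x) \<partial>\<Omega>) = (\<lambda>n. \<integral>y. h n y \<partial>\<mu> n)"
        unfolding distr_Y[symmetric] by (simp add: integral_distr)
      also have "(\<integral>x. Y' x ^ k * exp (- Y' x) / fact k \<partial>\<Omega>) = (\<integral>y. y ^ k * exp (- y) / fact k \<partial>P)"
        unfolding distr_Y'[symmetric] by (simp add: integral_distr)
      also have "\<dots> = poisson_mixture P k"
        unfolding poisson_mixture_def set_lebesgue_integral_def
      proof (rule integral_cong_AE)
        show "AE x in P. x ^ k * exp (- x) / fact k = indicat_real {0..} x *\<^sub>R (x ^ k * exp (- x) / fact k)"
          using AE_P by eventually_elim (use cd in auto)
      qed (auto simp: P.events_eq_borel)
      finally have "(\<lambda>n. \<integral>y. h n y \<partial>\<mu> n) \<longlonglongrightarrow> poisson_mixture P k" .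
      moreover have "\<forall>\<^sub>F n in sequentially. (\<integral>y. h n y \<partial>\<mu> n) = measure_pmf.expectation (p n)
          (\<lambda>a. real ((n - 1) choose k) * pmf (p n) a ^ k * (1 - pmf (p n) a) ^ (n - 1 - k))"
        using eventually_ge_at_top[of 1]
        by eventually_elim (auto simp: \<mu>_def integral_distr h_def)
      ultimately show ?thesis by (simp add: tendsto_cong)
    qed
    thus ?thesis by (rule that[OF cd supp_P])
  qed
qed

text \<open>Both sides equal the product measure of the \<open>p\<close>; the measurable space on the codomain is not
  discrete, since the alphabet type may be uncountable.\<close>

lemma (in prob_space) distr_iid_eq_Pi_pmf:
  assumes "finite I" "I \<noteq> {}"
    and indep: "indep_vars (\<lambda>_. count_space UNIV) X I"
    and distr: "\<And>i. i \<in> I \<Longrightarrow> distr M (count_space UNIV) (X i) = measure_pmf p"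
  shows "distr M (\<Pi>\<^sub>M i\<in>I. count_space UNIV) (\<lambda>\<omega>. \<lambda>i\<in>I. X i \<omega>)
    = distr (Pi_pmf I d (\<lambda>_. p)) (\<Pi>\<^sub>M i\<in>I. count_space UNIV) (\<lambda>x. \<lambda>i\<in>I. x i)"
proof -
  have "distr M (\<Pi>\<^sub>M i\<in>I. count_space UNIV) (\<lambda>\<omega>. \<lambda>i\<in>I. X i \<omega>)
      = (\<Pi>\<^sub>M i\<in>I. distr M (count_space UNIV) (X i))"
    using indep \<open>I \<noteq> {}\<close>
    by (subst indep_vars_iff_distr_eq_PiM'[symmetric]) (auto simp: indep_vars_def)
  also have "\<dots> = (\<Pi>\<^sub>M i\<in>I. measure_pmf p)"
    by (intro PiM_cong distr) auto
  finally have M: "distr M (\<Pi>\<^sub>M i\<in>I. count_space UNIV) (\<lambda>\<omega>. \<lambda>i\<in>I. X i \<omega>)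
    = (\<Pi>\<^sub>M i\<in>I. measure_pmf p)" .
  have "distr (Pi_pmf I d (\<lambda>_. p)) (\<Pi>\<^sub>M i\<in>I. count_space UNIV) (\<lambda>x. \<lambda>i\<in>I. x i)
      = (\<Pi>\<^sub>M i\<in>I. distr (Pi_pmf I d (\<lambda>_. p)) (count_space UNIV) (\<lambda>x. x i))"
    using indep_vars_Pi_pmf[OF \<open>finite I\<close>, of d "\<lambda>_. p"] \<open>I \<noteq> {}\<close>
    by (subst prob_space.indep_vars_iff_distr_eq_PiM'[OF measure_pmf.prob_space_axioms, symmetric]) auto
  also have "\<dots> = (\<Pi>\<^sub>M i\<in>I. measure_pmf p)"
    by (intro PiM_cong) (auto simp: Pi_pmf_component \<open>finite I\<close> simp flip: map_pmf_rep_eq)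
  finally show ?thesis by (simp only: M)
qed

lemma measurable_good_turing [measurable]:
  assumes "finite A"
  shows "(\<lambda>x. good_turing A n x k) \<in> borel_measurable (\<Pi>\<^sub>M i\<in>{1..n}. count_space UNIV)"
proof -
  have [measurable]: "Measurable.pred (\<Pi>\<^sub>M i\<in>{1..n}. count_space UNIV) (\<lambda>x. x i = a)" if "i \<in> {1..n}" for i a
    using that by (intro measurable_compose[OF measurable_component_singleton[of i]]) auto
  \<comment> \<open>As a finite sum of indicators of coordinate events, the count is measurable for
    the product sigma-algebra.\<close>
  have "(\<lambda>x. \<Sum>i\<in>{1..n}. if x i = a then 1 else 0 :: nat)
      \<in> measurable (\<Pi>\<^sub>M i\<in>{1..n}. count_space UNIV) (count_space UNIV)" for a
    by measurable
  also have "(\<lambda>x. \<Sum>i\<in>{1..n}. if x i = a then 1 else 0 :: nat) = (\<lambda>x. card {i\<in>{1..n}. x i = a})" for a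
    by (simp add: sum.If_cases Int_def)
  finally have [measurable]: "(\<lambda>x. card {i\<in>{1..n}. x i = a})
      \<in> measurable (\<Pi>\<^sub>M i\<in>{1..n}. count_space UNIV) (count_space UNIV)" for a .
  have "(\<lambda>x. real (k + 1) * (\<Sum>a\<in>A. if card {i\<in>{1..n}. x i = a} = k + 1 then 1 else 0) / real n)
      \<in> borel_measurable (\<Pi>\<^sub>M i\<in>{1..n}. count_space UNIV)"
    by measurable
  thus ?thesis
    by (simp add: good_turing_def prevalence_altdef[OF assms] of_bool_def)
qed

text \<open>Product measures live on functions that are \<open>undefined\<close> outside
  \<open>{1..n}\<close>, whereas \<open>Pi_pmf\<close> fills in its default \<open>d\<close>.
  Restriction reconciles the two.\<close>

lemma good_turing_restrict: "good_turing A n (\<lambda>i\<in>{1..n}. x i) k = good_turing A n x k"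
proof -
  have "{i\<in>{1..n}. restrict x {1..n} i = a} = {i\<in>{1..n}. x i = a}" for a
    by auto
  thus ?thesis by (simp only: good_turing_def prevalence_def)
qed

text \<open>The event is transported to \<open>Pi_pmf\<close>, where \<open>McDiarmid\<close>
  applies. Differences of order 1/n in \<open>n\<close> coordinates give an exponent linear in
  \<open>n\<close>, hence a geometric bound.\<close>

lemma (in prob_space) good_turing_concentration:
  fixes d :: 'b and k :: nat
  assumes "finite A" "n \<ge> 1" "\<epsilon> > 0"
    and indep: "indep_vars (\<lambda>_. count_space UNIV) X {1..n}"
    and distr: "\<And>i. i \<in> {1..n} \<Longrightarrow> distr M (count_space UNIV) (X i) = measure_pmf p"
  defines "E \<equiv> measure_pmf.expectation (Pi_pmf {1..n} d (\<lambda>_. p)) (\<lambda>x. good_turing A n x k)"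
  shows "random_variable borel (\<lambda>\<omega>. good_turing A n (\<lambda>i. X i \<omega>) k)"
    and "prob {\<omega>\<in>space M. \<bar>good_turing A n (\<lambda>i. X i \<omega>) k - E\<bar> \<ge> \<epsilon>}
      \<le> 2 * exp (- \<epsilon>\<^sup>2 / (32 * (real (k + 1))\<^sup>2)) ^ n"
proof -
  let ?S = "\<Pi>\<^sub>M i\<in>{1..n}. count_space UNIV"
  let ?R = "Pi_pmf {1..n} d (\<lambda>_. p)"
  let ?W = "\<lambda>\<omega>. \<lambda>i\<in>{1..n}. X i \<omega>"
  note [measurable] = measurable_good_turing[OF \<open>finite A\<close>]
  have W [measurable]: "?W \<in> measurable M ?S"
    using indep by (intro measurable_restrict) (auto simp: indep_vars_def)
  have V [measurable]: "(\<lambda>x. \<lambda>i\<in>{1..n}. x i) \<in> measurable (measure_pmf ?R) ?S"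
    by (intro measurable_restrict) auto
  have "(\<lambda>\<omega>. good_turing A n (?W \<omega>) k) \<in> borel_measurable M" by measurable
  thus "random_variable borel (\<lambda>\<omega>. good_turing A n (\<lambda>i. X i \<omega>) k)"
    by (simp only: good_turing_restrict)
  define T where "T = {x\<in>space ?S. \<bar>good_turing A n x k - E\<bar> \<ge> \<epsilon>}"
  have T: "T \<in> sets ?S" unfolding T_def by measurable
  have "{\<omega>\<in>space M. \<bar>good_turing A n (\<lambda>i. X i \<omega>) k - E\<bar> \<ge> \<epsilon>} = ?W -` T \<inter> space M"
    using measurable_space[OF W] by (auto simp: T_def good_turing_restrict simp del: One_nat_def)
  hence "prob {\<omega>\<in>space M. \<bar>good_turing A n (\<lambda>i. X i \<omega>) k - E\<bar> \<ge> \<epsilon>} = measure (distr M ?S ?W) T"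
    by (simp only: measure_distr[OF W T])
  also have "\<dots> = measure (distr ?R ?S (\<lambda>x. \<lambda>i\<in>{1..n}. x i)) T"
    using \<open>n \<ge> 1\<close> by (subst distr_iid_eq_Pi_pmf[OF _ _ indep distr]) auto
  also have "\<dots> = measure_pmf.prob ?R {x. \<bar>good_turing A n x k - E\<bar> \<ge> \<epsilon>}"
    unfolding measure_distr[OF V T]
    using measurable_space[OF V]
    by (intro arg_cong[where f = "measure_pmf.prob ?R"])
       (auto simp: T_def good_turing_restrict simp del: One_nat_def)
  also have "\<dots> \<le> 2 * exp (- \<epsilon>\<^sup>2 / (8 * real (card {1..n}) * (2 * real (k + 1) / n)\<^sup>2))"
    unfolding E_def
  proof (rule McDiarmid)
    show "\<bar>good_turing A n x k\<bar> \<le> real (k + 1) * card A / n" for x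
      using good_turing_le[OF \<open>finite A\<close>] good_turing_nonneg[of A n x k] by simp
    show "\<bar>good_turing A n (x(i := y)) k - good_turing A n x k\<bar> \<le> 2 * real (k + 1) / n" for x i y
      by (rule good_turing_fun_upd[OF \<open>finite A\<close>])
  qed (use assms in auto)
  also have "- \<epsilon>\<^sup>2 / (8 * real (card {1..n}) * (2 * real (k + 1) / n)\<^sup>2) = n * (- \<epsilon>\<^sup>2 / (32 * (real (k + 1))\<^sup>2))"
  proof -
    define K where "K = real (k + 1)"
    have "real n \<noteq> 0" "K \<noteq> 0" using \<open>n \<ge> 1\<close> by (simp_all add: K_def)
    thus ?thesis unfolding K_def[symmetric] by (simp add: power2_eq_square field_simps)
  qed
  finally show "prob {\<omega>\<in>space M. \<bar>good_turing A n (\<lambda>i. X i \<omega>) k - E\<bar> \<ge> \<epsilon>}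
      \<le> 2 * exp (- \<epsilon>\<^sup>2 / (32 * (real (k + 1))\<^sup>2)) ^ n"
    by (simp only: exp_of_nat_mult)
qed

text \<open>The first Borel-Cantelli lemma asks only for summable probabilities, whatever the
  dependence across \<open>n\<close>. It is applied to the countably many thresholds
  \<open>1 / real (Suc j)\<close>.\<close>

lemma (in prob_space) AE_good_turing_tendsto:
  assumes "rare_events_source A p P" and "iid_samples M p X"
  shows "AE \<omega> in M. (\<lambda>n. good_turing (A n) n (\<lambda>i. X n i \<omega>) k) \<longlonglongrightarrow> poisson_mixture P k"
proof -
  have fin: "\<And>n. n \<ge> 1 \<Longrightarrow> finite (A n)" and supp: "\<And>n. n \<ge> 1 \<Longrightarrow> set_pmf (p n) \<subseteq> A n"
    using assms by (auto simp: rare_events_source_def)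
  have iid: "indep_vars (\<lambda>_. count_space UNIV) (X n) {1..n}"
      "\<And>i. i \<in> {1..n} \<Longrightarrow> distr M (count_space UNIV) (X n i) = measure_pmf (p n)" if "n \<ge> 1" for n
    using assms that by (auto simp: iid_samples_def)
  define G where "G = (\<lambda>n \<omega>. good_turing (A n) n (\<lambda>i. X n i \<omega>) k)"
  define E where "E = (\<lambda>n. measure_pmf.expectation (Pi_pmf {1..n} undefined (\<lambda>_. p n)) (\<lambda>x. good_turing (A n) n x k))"
  \<comment> \<open>Empty at \<open>n = 0\<close>, where nothing is known about the samples, so that
    measurability and summability hold for all indices.\<close>
  define B where "B = (\<lambda>\<epsilon> n. if n \<ge> 1 then {\<omega>\<in>space M. \<bar>G n \<omega> - E n\<bar> \<ge> \<epsilon>} else {})"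
  have [measurable]: "G n \<in> borel_measurable M" if "n \<ge> 1" for n
    unfolding G_def
    using good_turing_concentration(1)[OF fin[OF that] that zero_less_one iid[OF that]] .
  have meas: "B \<epsilon> n \<in> events" for \<epsilon> n
    by (cases "n \<ge> 1") (simp_all add: B_def)
  have "AE \<omega> in M. \<forall>\<^sub>F n in sequentially. \<omega> \<in> space M - B (1 / real (Suc j)) n" for j
  proof (rule borel_cantelli_AE1[OF meas])
    define r where "r = exp (- (1 / real (Suc j))\<^sup>2 / (32 * (real (k + 1))\<^sup>2))"
    have "r < 1" unfolding r_def exp_less_one_iff by (intro divide_neg_pos) auto
    moreover have "r > 0" by (simp add: r_def)
    ultimately have "summable (\<lambda>n. 2 * r ^ n)"
      by (intro summable_mult summable_geometric) auto
    moreover have "norm (prob (B (1 / real (Suc j)) n)) \<le> 2 * r ^ n" for n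
    proof (cases "n \<ge> 1")
      case True
      have "0 < 1 / real (Suc j)" by simp
      from good_turing_concentration(2)[OF fin[OF True] True this iid[OF True], of k undefined] True
      show ?thesis by (simp add: B_def G_def E_def r_def)
    qed (use \<open>r > 0\<close> in \<open>simp add: B_def\<close>)
    ultimately show "summable (\<lambda>n. prob (B (1 / real (Suc j)) n))"
      by (rule summable_comparison_test'[where N = 0])
  qed (simp add: emeasure_eq_measure)
  hence "AE \<omega> in M. \<forall>j. \<forall>\<^sub>F n in sequentially. \<omega> \<in> space M - B (1 / real (Suc j)) n"
    by (simp add: AE_all_countable)
  thus ?thesis
  proof eventually_elim
    case (elim \<omega>)
    have "(\<lambda>n. G n \<omega> - E n) \<longlonglongrightarrow> 0"
    proof (rule tendstoI)
      fix e :: real assume "e > 0"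
      then obtain j where j: "1 / real (Suc j) < e"
        using nat_approx_posE by blast
      show "\<forall>\<^sub>F n in sequentially. dist (G n \<omega> - E n) 0 < e"
        using elim[rule_format, of j] eventually_ge_at_top[of 1]
      proof eventually_elim
        case (elim n)
        thus ?case using j by (auto simp: B_def)
      qed
    qed
    moreover obtain c d where "(\<lambda>n. measure_pmf.expectation (p n)
        (\<lambda>a. real ((n - 1) choose k) * pmf (p n) a ^ k * (1 - pmf (p n) a) ^ (n - 1 - k)))
      \<longlonglongrightarrow> poisson_mixture P k"
      using rare_events_source_limit[OF assms(1)] by metis
    hence "E \<longlonglongrightarrow> poisson_mixture P k"
    proof (rule Lim_transform_eventually)
      show "\<forall>\<^sub>F n in sequentially. measure_pmf.expectation (p n)
          (\<lambda>a. real ((n - 1) choose k) * pmf (p n) a ^ k * (1 - pmf (p n) a) ^ (n - 1 - k)) = E n"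
        unfolding E_def using eventually_ge_at_top[of 1]
        by eventually_elim (rule expectation_good_turing[OF fin supp, symmetric])
    qed
    ultimately show ?case
      using tendsto_add[of "\<lambda>n. G n \<omega> - E n" 0 sequentially E] by (simp add: G_def)
  qed
qed

subsection \<open>Optimality of the maximum likelihood mixture\<close>

lemma Poisson_weight_bounds:
  fixes x :: real
  assumes "x \<ge> 0"
  shows "0 \<le> x ^ k * exp (- x) / fact k" "x ^ k * exp (- x) / fact k \<le> 1"
    and "(\<Sum>j<K. x ^ j * exp (- x) / fact j) \<le> 1"
proof -
  show 0: "0 \<le> x ^ k * exp (- x) / fact k" for k using assms by simp
  have "(\<Sum>j<K. x ^ j * exp (- x) / fact j) = exp (- x) * (\<Sum>j<K. x ^ j /\<^sub>R fact j)" for K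
    by (simp add: sum_distrib_left field_simps)
  also have "\<dots> K \<le> exp (- x) * exp x" for K
    using assms sum_le_suminf[OF sums_summable[OF exp_converges[of x]], of "{..<K}"]
      sums_unique[OF exp_converges[of x]]
    by (intro mult_left_mono) auto
  finally show 1: "(\<Sum>j<K. x ^ j * exp (- x) / fact j) \<le> 1" for K
    by (simp flip: exp_add)
  show "x ^ k * exp (- x) / fact k \<le> 1"
    using 1[of "Suc k"] sum_nonneg[of "{..<k}" "\<lambda>j. x ^ j * exp (- x) / fact j", OF 0]
    unfolding sum.lessThan_Suc by linarith
qed

lemma Poisson_weights_sums: "(\<lambda>j. x ^ j * exp (- x) / fact j) sums (1 :: real)"
proof -
  have "(\<lambda>j. exp (- x) * (x ^ j /\<^sub>R fact j)) sums (exp (- x) * exp x)"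
    by (intro sums_mult exp_converges)
  thus ?thesis by (simp add: field_simps flip: exp_add)
qed

context
  fixes Q :: "real measure"
  assumes Q: "prob_on_nonneg Q"
begin

interpretation Q: real_distribution Q
  using Q by (simp add: prob_on_nonneg_def)

lemma prob_on_nonneg_AE: "AE x in Q. x \<ge> 0"
proof -
  have "Q.prob {0..} = 1" using Q by (simp add: prob_on_nonneg_def)
  thus ?thesis by (subst (asm) Q.prob_eq_1) auto
qed

lemma poisson_mixture_altdef: "poisson_mixture Q k = (\<integral>x. x ^ k * exp (- x) / fact k \<partial>Q)"
  unfolding poisson_mixture_def set_lebesgue_integral_def
  by (rule integral_cong_AE) (use prob_on_nonneg_AE in \<open>auto elim!: eventually_mono\<close>)

lemma integrable_Poisson_weight: "integrable Q (\<lambda>x. x ^ k * exp (- x) / fact k)"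
proof (rule Q.integrable_const_bound[where B = 1])
  show "AE x in Q. norm (x ^ k * exp (- x) / fact k) \<le> 1"
    using prob_on_nonneg_AE by eventually_elim (use Poisson_weight_bounds in auto)
qed simp

lemma poisson_mixture_nonneg: "poisson_mixture Q k \<ge> 0"
  unfolding poisson_mixture_altdef
  by (rule integral_nonneg_AE) (use prob_on_nonneg_AE in \<open>auto elim!: eventually_mono\<close>)

lemma sum_poisson_mixture:
  "(\<Sum>k<K. poisson_mixture Q k) = (\<integral>x. (\<Sum>k<K. x ^ k * exp (- x) / fact k) \<partial>Q)"
  unfolding poisson_mixture_altdef
  by (rule Bochner_Integration.integral_sum[symmetric]) (rule integrable_Poisson_weight)

lemma sum_poisson_mixture_le_1: "(\<Sum>k<K. poisson_mixture Q k) \<le> 1"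
proof -
  have "(\<integral>x. (\<Sum>k<K. x ^ k * exp (- x) / fact k) \<partial>Q) \<le> (\<integral>x. 1 \<partial>Q)"
  proof (rule integral_mono_AE)
    show "AE x in Q. (\<Sum>k<K. x ^ k * exp (- x) / fact k) \<le> 1"
      using prob_on_nonneg_AE by eventually_elim (rule Poisson_weight_bounds)
  qed (auto intro!: Bochner_Integration.integrable_sum integrable_Poisson_weight)
  thus ?thesis by (simp add: sum_poisson_mixture Q.prob_space[unfolded Q.space_eq_univ])
qed

lemma poisson_mixture_le_1: "poisson_mixture Q k \<le> 1"
  using sum_poisson_mixture_le_1[of "Suc k"] sum_nonneg[of "{..<k}" "poisson_mixture Q"]
    poisson_mixture_nonneg by simp

text \<open>Dominated convergence of the partial sums. The exact total is needed for the limit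
  \<open>P\<close>; for the maximizers the bound \<open>sum_poisson_mixture_le_1\<close>
  suffices.\<close>

lemma poisson_mixture_sums: "poisson_mixture Q sums 1"
proof -
  have "(\<lambda>K. \<integral>x. (\<Sum>k<K. x ^ k * exp (- x) / fact k) \<partial>Q) \<longlonglongrightarrow> (\<integral>x. 1 \<partial>Q)"
  proof (rule integral_dominated_convergence[where w = "\<lambda>_. 1"])
    show "AE x in Q. (\<lambda>K. \<Sum>k<K. x ^ k * exp (- x) / fact k) \<longlonglongrightarrow> 1"
      using Poisson_weights_sums by (simp add: sums_def)
    show "AE x in Q. norm (\<Sum>k<K. x ^ k * exp (- x) / fact k) \<le> 1" for K
      using prob_on_nonneg_AE
    proof eventually_elim
      case (elim x)
      thus ?case using Poisson_weight_bounds(3)[OF elim, of K] by (simp add: sum_nonneg)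
    qed
  qed auto
  thus ?thesis by (simp add: sums_def sum_poisson_mixture Q.prob_space[unfolded Q.space_eq_univ])
qed

end

text \<open>On \<open>{c..d}\<close> the Poisson weight is bounded below by a positive constant.
  Positivity gives \<open>P\<close> a finite log-likelihood, which makes it a usable
  competitor.\<close>

lemma poisson_mixture_pos:
  assumes Q: "prob_on_nonneg Q" and "0 < c" "measure Q {c..d} = 1"
  shows "poisson_mixture Q k > 0"
proof -
  interpret Q: real_distribution Q
    using Q by (simp add: prob_on_nonneg_def)
  have AE: "AE x in Q. x \<in> {c..d}"
    using assms(3) by (subst (asm) Q.prob_eq_1) auto
  have "(\<integral>x. c ^ k * exp (- d) / fact k \<partial>Q) \<le> poisson_mixture Q k"
    unfolding poisson_mixture_altdef[OF Q]
  proof (rule integral_mono_AE)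
    show "AE x in Q. c ^ k * exp (- d) / fact k \<le> x ^ k * exp (- x) / fact k"
      using AE by eventually_elim
        (use \<open>0 < c\<close> in \<open>auto intro!: divide_right_mono mult_mono power_mono\<close>)
  qed (auto intro: integrable_Poisson_weight Q)
  moreover have "0 < c ^ k * exp (- d) / fact k" using \<open>0 < c\<close> by simp
  ultimately show ?thesis by (simp add: Q.prob_space[unfolded Q.space_eq_univ])
qed

text \<open>A Bernoulli choice between \<open>Q\<close> and \<open>R\<close>, realized by
  \<open>bind\<close>, averages their integrals. It provides the segment from the maximizer to a
  competitor.\<close>

lemma prob_on_nonneg_mixture:
  assumes Q: "prob_on_nonneg Q" and R: "prob_on_nonneg R" and t: "0 \<le> t" "t \<le> 1"
  obtains S where "prob_on_nonneg S"
    "\<And>k. poisson_mixture S k = (1 - t) * poisson_mixture Q k + t * poisson_mixture R k"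
proof -
  interpret Q: real_distribution Q using Q by (simp add: prob_on_nonneg_def)
  interpret R: real_distribution R using R by (simp add: prob_on_nonneg_def)
  define N where "N = (\<lambda>b. if b then R else Q)"
  define S where "S = measure_pmf (bernoulli_pmf t) \<bind> N"
  have N: "N \<in> measurable (measure_pmf (bernoulli_pmf t)) (subprob_algebra borel)"
    by (auto simp: N_def space_subprob_algebra Q.subprob_space_axioms R.subprob_space_axioms)
  have "prob_space S" unfolding S_def
    by (rule measure_pmf.prob_space_bind[OF _ N])
       (auto simp: N_def Q.prob_space_axioms R.prob_space_axioms)
  moreover have [simp]: "sets S = sets borel" unfolding S_def
    by (rule sets_bind[OF sets_kernel[OF N]]) auto
  ultimately interpret S: real_distribution S
    by (simp add: real_distribution_def real_distribution_axioms_def)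
  have int: "(\<integral>x. f x \<partial>S) = (1 - t) * (\<integral>x. f x \<partial>Q) + t * (\<integral>x. f x \<partial>R)"
    if "f \<in> borel_measurable borel" "\<And>x. \<bar>f x\<bar> \<le> 1" for f :: "real \<Rightarrow> real"
  proof -
    have "(\<integral>x. f x \<partial>S) = (\<integral>b. (\<integral>x. f x \<partial>N b) \<partial>measure_pmf (bernoulli_pmf t))"
      unfolding S_def
      by (rule integral_bind[OF _ _ N, where B' = 1 and B = 1])
         (use that in \<open>auto simp: N_def measure_pmf.finite_measure_axioms Q.emeasure_space_1[unfolded Q.space_eq_univ] R.emeasure_space_1[unfolded R.space_eq_univ]\<close>)
    also have "\<dots> = (1 - t) * (\<integral>x. f x \<partial>Q) + t * (\<integral>x. f x \<partial>R)"
      using t by (subst integral_measure_pmf_real[where A = UNIV]) (auto simp: N_def UNIV_bool)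
    finally show ?thesis .
  qed
  have "\<bar>indicator {0..} x\<bar> \<le> (1 :: real)" for x :: real
    by (simp split: split_indicator)
  from int[of "indicator {0..}", OF _ this] have "measure S {0..} = 1"
    using Q R by (simp add: prob_on_nonneg_def)
  hence "prob_on_nonneg S"
    by (simp add: prob_on_nonneg_def S.real_distribution_axioms)
  moreover have "poisson_mixture S k = (1 - t) * poisson_mixture Q k + t * poisson_mixture R k" for k
    unfolding poisson_mixture_def set_lebesgue_integral_def
    by (rule int) (use Poisson_weight_bounds[of _ k] in \<open>auto simp: indicator_def abs_le_iff\<close>)
  ultimately show ?thesis by (rule that)
qed

section \<open>The log-likelihood and the first-order condition at its maximizer\<close>

lemma mixture_log_likelihood_eq:
  assumes "\<And>k. k \<ge> n \<Longrightarrow> \<phi> k = 0"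
  shows "mixture_log_likelihood \<phi> Q = (\<Sum>k<n. ereal (\<phi> k) * log_ext (poisson_mixture Q k))"
  unfolding mixture_log_likelihood_def
  by (rule suminf_finite) (use assms in \<open>auto simp: not_less\<close>)

text \<open>Where \<open>\<phi> k = 0\<close> both terms vanish, even if the coefficient is 0:
  \<open>0 * (-\<infinity>) = 0\<close> in \<open>ereal\<close>, and \<open>ln\<close> is multiplied
  by 0 on the real side.\<close>

lemma mixture_log_likelihood_finite:
  assumes "\<And>k. k \<ge> n \<Longrightarrow> \<phi> k = 0" "\<And>k. \<phi> k > 0 \<Longrightarrow> poisson_mixture Q k > 0" "\<And>k. \<phi> k \<ge> 0"
  shows "mixture_log_likelihood \<phi> Q = ereal (\<Sum>k<n. \<phi> k * ln (poisson_mixture Q k))"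
proof -
  have "ereal (\<phi> k) * log_ext (poisson_mixture Q k) = ereal (\<phi> k * ln (poisson_mixture Q k))" for k
  proof (cases "\<phi> k = 0")
    case False
    with assms(3)[of k] have "\<phi> k > 0" by simp
    from assms(2)[OF this] show ?thesis by (simp add: log_ext_def)
  qed (simp add: zero_ereal_def[symmetric])
  thus ?thesis by (simp add: mixture_log_likelihood_eq[OF assms(1)])
qed

text \<open>Coefficients are at most 1, so every term is nonpositive and nothing can compensate a
  single \<open>-\<infinity>\<close>.\<close>

lemma mixture_log_likelihood_infinite:
  assumes "\<And>k. k \<ge> n \<Longrightarrow> \<phi> k = 0" "\<And>k. \<phi> k \<ge> 0" "\<phi> k > 0" "poisson_mixture Q k \<le> 0"
    and Q: "prob_on_nonneg Q"
  shows "mixture_log_likelihood \<phi> Q = -\<infinity>"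
proof -
  have "k < n" using assms(1,3) by (metis less_irrefl not_less)
  have "log_ext (poisson_mixture Q j) \<le> 0" for j
    using poisson_mixture_le_1[OF Q, of j] by (auto simp: log_ext_def)
  hence le: "ereal (\<phi> j) * log_ext (poisson_mixture Q j) \<le> 0" for j
    using assms(2) by (simp add: ereal_mult_le_0_iff)
  have "(\<Sum>j<n. ereal (\<phi> j) * log_ext (poisson_mixture Q j))
      = ereal (\<phi> k) * log_ext (poisson_mixture Q k)
        + (\<Sum>j\<in>{..<n} - {k}. ereal (\<phi> j) * log_ext (poisson_mixture Q j))"
    using \<open>k < n\<close> by (intro sum.remove) auto
  also have "\<dots> \<le> ereal (\<phi> k) * log_ext (poisson_mixture Q k) + 0"
    by (intro add_left_mono sum_nonpos le)
  also have "\<dots> = -\<infinity>"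
    using assms(3,4) by (simp add: log_ext_def)
  finally show ?thesis by (simp add: mixture_log_likelihood_eq[OF assms(1)])
qed

text \<open>First-order optimality: the likelihood does not increase along the segment from the maximizer
  to a competitor.\<close>

lemma mixing_MLE_gradient:
  assumes MLE: "is_mixing_MLE \<phi> Q" and P: "prob_on_nonneg P" and pos: "\<And>k. poisson_mixture P k > 0"
    and \<phi>: "\<And>k. k \<ge> n \<Longrightarrow> \<phi> k = 0" "\<And>k. \<phi> k \<ge> 0"
  shows "\<And>k. \<phi> k > 0 \<Longrightarrow> poisson_mixture Q k > 0"
    and "(\<Sum>k<n. \<phi> k * poisson_mixture P k / poisson_mixture Q k) \<le> (\<Sum>k<n. \<phi> k)"
proof -
  define q where "q = poisson_mixture Q"
  define r where "r = poisson_mixture P"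
  have Q: "prob_on_nonneg Q" and opt: "\<And>R. prob_on_nonneg R \<Longrightarrow>
      mixture_log_likelihood \<phi> R \<le> mixture_log_likelihood \<phi> Q"
    using MLE by (auto simp: is_mixing_MLE_def is_arg_max_def not_less)
  have "mixture_log_likelihood \<phi> Q \<noteq> -\<infinity>"
    using opt[OF P] mixture_log_likelihood_finite[of n \<phi> P] \<phi> pos by auto
  thus qpos: "poisson_mixture Q k > 0" if "\<phi> k > 0" for k
    using mixture_log_likelihood_infinite[of n \<phi> k Q] \<phi> that Q by force
  \<comment> \<open>\<open>D\<close> is the derivative at 0 of \<open>f\<close>, the log-likelihood
    along the segment from \<open>Q\<close> to \<open>P\<close>. Terms with
    \<open>\<phi> k = 0\<close> are constant, so a vanishing \<open>q k\<close> does no harm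
    there.\<close>
  define D where "D = (\<Sum>k<n. \<phi> k * ((r k - q k) / q k))"
  define f where "f = (\<lambda>t. \<Sum>k<n. \<phi> k * ln ((1 - t) * q k + t * r k))"
  have le: "f t \<le> f 0" if t: "0 < t" "t < 1" for t
  proof -
    obtain S where S: "prob_on_nonneg S" "\<And>k. poisson_mixture S k = (1 - t) * q k + t * r k"
      using prob_on_nonneg_mixture[OF Q P, of t] t unfolding q_def r_def by auto
    have "poisson_mixture S k > 0" for k
      unfolding S(2) using t pos[of k] poisson_mixture_nonneg[OF Q, of k]
      by (intro add_nonneg_pos) (auto simp: q_def r_def)
    hence "mixture_log_likelihood \<phi> S = ereal (f t)"
      using mixture_log_likelihood_finite[of n \<phi> S] \<phi> by (simp add: f_def S(2))
    moreover have "mixture_log_likelihood \<phi> Q = ereal (f 0)"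
      using mixture_log_likelihood_finite[of n \<phi> Q] \<phi> qpos by (simp add: f_def q_def)
    ultimately show ?thesis using opt[OF S(1)] by simp
  qed
  have "(f has_field_derivative D) (at 0)"
    unfolding f_def D_def
  proof (rule DERIV_sum)
    fix k
    show "((\<lambda>t. \<phi> k * ln ((1 - t) * q k + t * r k)) has_field_derivative \<phi> k * ((r k - q k) / q k)) (at 0)"
    proof (cases "\<phi> k = 0")
      case False
      with \<phi>(2)[of k] qpos have "q k > 0" by (simp add: q_def less_eq_real_def)
      thus ?thesis
        by (auto intro!: derivative_eq_intros simp: field_simps)
    qed simp
  qed
  have "D \<le> 0"
  proof (rule ccontr)
    assume "\<not> D \<le> 0"
    with DERIV_pos_inc_right[OF \<open>(f has_field_derivative D) (at 0)\<close>] obtain \<delta>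
      where \<delta>: "\<delta> > 0" "\<And>h. h > 0 \<Longrightarrow> h < \<delta> \<Longrightarrow> f 0 < f (0 + h)" by auto
    \<comment> \<open>Small enough for the increase given by a positive derivative, and below 1 to
      stay on the segment.\<close>
    define h where "h = min (\<delta> / 2) (1 / 2)"
    have "0 < h" "h < \<delta>" "h < 1" using \<delta>(1) by (auto simp: h_def)
    with \<delta>(2)[of h] le[of h] show False by simp
  qed
  moreover have "D = (\<Sum>k<n. \<phi> k * r k / q k) - (\<Sum>k<n. \<phi> k)"
    unfolding D_def sum_subtractf[symmetric]
  proof (rule sum.cong[OF refl])
    fix k
    show "\<phi> k * ((r k - q k) / q k) = \<phi> k * r k / q k - \<phi> k"
    proof (cases "\<phi> k = 0")
      case False
      with \<phi>(2)[of k] qpos have "q k > 0" by (simp add: q_def less_eq_real_def)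
      thus ?thesis by (simp add: field_simps)
    qed simp
  qed
  ultimately show "(\<Sum>k<n. \<phi> k * poisson_mixture P k / poisson_mixture Q k) \<le> (\<Sum>k<n. \<phi> k)"
    by (simp add: q_def r_def)
qed

subsection \<open>From mixture coefficients to weak convergence\<close>

text \<open>The gradient inequality turns the square of \<open>sqrt (\<phi> r / q) - sqrt q\<close>, summed over \<open>k < K\<close>, into
  a quantity that is small as soon as \<open>\<phi>\<close> is close to \<open>r\<close> and \<open>r\<close> has little mass beyond \<open>K\<close>.\<close>

lemma sqrt_diff_le_of_gradient:
  fixes \<phi> q r :: "nat \<Rightarrow> real"
  assumes nonneg: "\<And>k. \<phi> k \<ge> 0" "\<And>k. q k \<ge> 0" "\<And>k. r k \<ge> 0"
    and pos: "\<And>k. \<phi> k > 0 \<Longrightarrow> q k > 0"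
    and grad: "(\<Sum>k<K. \<phi> k * r k / q k) \<le> 1"
    and sum_q: "(\<Sum>k<K. q k) \<le> 1"
    and q_le: "\<And>k. q k \<le> 1" and "k < K"
  shows "(sqrt (\<phi> k * r k) - q k)\<^sup>2 \<le> 2 - 2 * (\<Sum>k<K. sqrt (\<phi> k * r k))"
proof -
  \<comment> \<open>Chosen so that in the square of \<open>u - sqrt q\<close> the first term is the
    summand of the gradient inequality and the cross term is free of \<open>q\<close>.\<close>
  define u where "u = (\<lambda>k. sqrt (\<phi> k * r k / q k))"
  have uq: "u j * sqrt (q j) = sqrt (\<phi> j * r j)" for j
  proof (cases "\<phi> j = 0")
    case False
    with nonneg(1)[of j] pos[of j] have "q j > 0" by simp
    thus ?thesis unfolding u_def by (simp flip: real_sqrt_mult)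
  qed (simp add: u_def)
  have sq: "(u j)\<^sup>2 = \<phi> j * r j / q j" "(sqrt (q j))\<^sup>2 = q j" for j
    using nonneg by (simp_all add: u_def)
  have "sqrt (\<phi> k * r k) - q k = sqrt (q k) * (u k - sqrt (q k))"
    using nonneg(2)[of k] by (simp add: algebra_simps flip: uq)
  hence "(sqrt (\<phi> k * r k) - q k)\<^sup>2 = q k * (u k - sqrt (q k))\<^sup>2"
    by (simp add: power_mult_distrib sq)
  also have "\<dots> \<le> 1 * (u k - sqrt (q k))\<^sup>2"
    using q_le by (intro mult_right_mono) auto
  also have "\<dots> = (\<Sum>j\<in>{k}. (u j - sqrt (q j))\<^sup>2)" by simp
  also have "\<dots> \<le> (\<Sum>j<K. (u j - sqrt (q j))\<^sup>2)"
    using \<open>k < K\<close> by (intro sum_mono2) auto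
  also have "\<dots> = (\<Sum>j<K. \<phi> j * r j / q j + q j - 2 * sqrt (\<phi> j * r j))"
    by (simp add: power2_diff sq mult.assoc uq)
  also have "\<dots> = (\<Sum>j<K. \<phi> j * r j / q j) + (\<Sum>j<K. q j) - 2 * (\<Sum>j<K. sqrt (\<phi> j * r j))"
    by (simp add: sum.distrib sum_subtractf sum_distrib_left)
  also have "\<dots> \<le> 2 - 2 * (\<Sum>j<K. sqrt (\<phi> j * r j))"
    using grad sum_q by simp
  finally show ?thesis .
qed

text \<open>First \<open>K\<close> is chosen so that \<open>r\<close> has little mass beyond it,
  then \<open>n\<close> large, so convergence of finitely many \<open>\<phi> n j\<close> suffices.
  Both \<open>\<phi> n k\<close> and \<open>q n k\<close> are compared with
  \<open>sqrt (\<phi> n k * r k)\<close>, which tends to \<open>r k\<close>.\<close>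

lemma tendsto_of_gradient:
  fixes \<phi> q :: "nat \<Rightarrow> nat \<Rightarrow> real" and r :: "nat \<Rightarrow> real"
  assumes nonneg: "\<And>n k. n \<ge> 1 \<Longrightarrow> \<phi> n k \<ge> 0" "\<And>n k. n \<ge> 1 \<Longrightarrow> q n k \<ge> 0" "\<And>k. r k \<ge> 0"
    and pos: "\<And>n k. n \<ge> 1 \<Longrightarrow> \<phi> n k > 0 \<Longrightarrow> q n k > 0"
    and grad: "\<And>n K. n \<ge> 1 \<Longrightarrow> (\<Sum>k<K. \<phi> n k * r k / q n k) \<le> 1"
    and sum_q: "\<And>n K. n \<ge> 1 \<Longrightarrow> (\<Sum>k<K. q n k) \<le> 1"
    and q_le: "\<And>n k. n \<ge> 1 \<Longrightarrow> q n k \<le> 1"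
    and sum_r: "r sums 1"
    and lim: "\<And>k. (\<lambda>n. \<phi> n k) \<longlonglongrightarrow> r k"
  shows "(\<lambda>n. q n k) \<longlonglongrightarrow> r k"
proof -
  have sqrt_lim: "(\<lambda>n. sqrt (\<phi> n j * r j)) \<longlonglongrightarrow> r j" for j
    using tendsto_real_sqrt[OF tendsto_mult[OF lim tendsto_const], of j "r j"] nonneg(3)[of j]
    by (simp add: real_sqrt_mult)
  have "(\<lambda>n. sqrt (\<phi> n k * r k) - q n k) \<longlonglongrightarrow> 0"
  proof (rule tendstoI)
    fix e :: real assume "e > 0"
    have "(\<lambda>K. 2 - 2 * (\<Sum>j<K. r j)) \<longlonglongrightarrow> 2 - 2 * 1"
      using sum_r by (intro tendsto_intros) (simp add: sums_def)
    hence "\<forall>\<^sub>F K in sequentially. 2 - 2 * (\<Sum>j<K. r j) < e\<^sup>2"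
      using \<open>e > 0\<close> by (intro order_tendstoD(2)) auto
    then obtain K where K: "2 - 2 * (\<Sum>j<K. r j) < e\<^sup>2" "k < K"
      using eventually_happens'[OF sequentially_bot eventually_conj[OF _ eventually_gt_at_top[of k]]]
      by blast
    have "(\<lambda>n. 2 - 2 * (\<Sum>j<K. sqrt (\<phi> n j * r j))) \<longlonglongrightarrow> 2 - 2 * (\<Sum>j<K. r j)"
      by (intro tendsto_intros sqrt_lim)
    hence "\<forall>\<^sub>F n in sequentially. 2 - 2 * (\<Sum>j<K. sqrt (\<phi> n j * r j)) < e\<^sup>2"
      using K by (intro order_tendstoD(2))
    thus "\<forall>\<^sub>F n in sequentially. dist (sqrt (\<phi> n k * r k) - q n k) 0 < e"
      using eventually_ge_at_top[of 1]
    proof eventually_elim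
      case (elim n)
      have "(sqrt (\<phi> n k * r k) - q n k)\<^sup>2 \<le> 2 - 2 * (\<Sum>j<K. sqrt (\<phi> n j * r j))"
        by (rule sqrt_diff_le_of_gradient) (use elim K assms in auto)
      also have "\<dots> < e\<^sup>2" by (rule elim)
      finally have "\<bar>sqrt (\<phi> n k * r k) - q n k\<bar> < e"
        using \<open>e > 0\<close> by (metis abs_le_square_iff abs_of_pos not_le)
      thus ?case by simp
    qed
  qed
  from tendsto_diff[OF sqrt_lim[of k] this] show ?thesis by simp
qed

text \<open>Markov's inequality in pointwise form: \<open>(x / D) ^ m \<ge> 1\<close> beyond
  \<open>D\<close>.\<close>

lemma weight_moment_bound:
  fixes x D :: real
  assumes "x \<ge> 0" "D > 0"
  shows "indicator {D<..} x * (x ^ j * exp (- x)) \<le> x ^ (j + m) * exp (- x) / D ^ m"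
proof (cases "x > D")
  case True
  hence "x ^ j * exp (- x) * D ^ m \<le> x ^ j * exp (- x) * x ^ m"
    using assms by (intro mult_left_mono power_mono) auto
  thus ?thesis using True assms by (simp add: power_add field_simps)
qed (use assms in simp)

text \<open>A limit carried by \<open>{0..d}\<close> makes the moments of \<open>exp (- x) dQ\<^sub>n\<close> grow at most like \<open>d ^ k\<close>,
  so that no mass of the \<open>Q n\<close> is left beyond \<open>2 * d\<close>; on \<open>{0..2 * d}\<close> the functions
  \<open>x ^ k * exp (- x)\<close> span a dense space by the Weierstrass theorem.\<close>

lemma weak_conv_m_of_poisson_mixture:
  assumes Q: "\<And>n. prob_on_nonneg (Q n)" and P: "prob_on_nonneg P"
    and "d > 0" and supp: "measure P {0..d} = 1"
    and lim: "\<And>k. (\<lambda>n. poisson_mixture (Q n) k) \<longlonglongrightarrow> poisson_mixture P k"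
  shows "weak_conv_m Q P"
proof -
  interpret Q: real_distribution "Q n" for n using Q by (simp add: prob_on_nonneg_def)
  interpret P: real_distribution P using P by (simp add: prob_on_nonneg_def)
  \<comment> \<open>Any cutoff above \<open>d\<close> makes the tail bound
    \<open>d ^ (j + m) / D ^ m\<close> decay in \<open>m\<close>; with \<open>2 * d\<close> it
    equals \<open>d ^ j * (1 / 2) ^ m\<close>.\<close>
  define D where "D = 2 * d"
  have D: "D > 0" "d < D" using \<open>d > 0\<close> by (auto simp: D_def)
  have AE_Q: "AE x in Q n. x \<ge> 0" for n by (rule prob_on_nonneg_AE[OF Q])
  have AE_P: "AE x in P. x \<in> {0..d}"
    using supp by (subst (asm) P.prob_eq_1) auto
  define w where "w = (\<lambda>k (x :: real). x ^ k * exp (- x))"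
  have w_meas [measurable]: "w k \<in> borel_measurable borel" for k by (simp add: w_def)
  have w_eq: "w k = (\<lambda>x. fact k * (x ^ k * exp (- x) / fact k))" for k by (simp add: w_def)
  have w_int: "integrable R (w k)" if "prob_on_nonneg R" for R k
    unfolding w_eq by (intro integrable_mult_right integrable_Poisson_weight that)
  have w_mix: "(\<integral>x. w k x \<partial>R) = fact k * poisson_mixture R k" if "prob_on_nonneg R" for R k
    unfolding w_eq poisson_mixture_altdef[OF that] by (rule integral_mult_right_zero)
  have w_lim: "(\<lambda>n. \<integral>x. w k x \<partial>Q n) \<longlonglongrightarrow> (\<integral>x. w k x \<partial>P)" for k
    unfolding w_mix[OF Q] w_mix[OF P] by (intro tendsto_intros lim)
  have w_P: "(\<integral>x. w k x \<partial>P) \<le> d ^ k" for k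
  proof -
    have "(\<integral>x. w k x \<partial>P) \<le> (\<integral>x. d ^ k \<partial>P)"
    proof (rule integral_mono_AE)
      show "AE x in P. w k x \<le> d ^ k"
        using AE_P
      proof eventually_elim
        case (elim x)
        hence "x ^ k * exp (- x) \<le> d ^ k * 1" by (intro mult_mono power_mono) auto
        thus ?case by (simp add: w_def)
      qed
    qed (auto intro: w_int P)
    thus ?thesis by (simp add: P.prob_space[unfolded P.space_eq_univ])
  qed
  \<comment> \<open>The jump of this cutoff at \<open>D\<close> is harmless: truncated weights are
    handled as full weights minus a vanishing tail, not as continuous test functions.\<close>
  define I where "I = (indicator {0..D} :: real \<Rightarrow> real)"
  have I_meas [measurable]: "I \<in> borel_measurable borel" by (simp add: I_def)
  have Iw_int: "integrable R (\<lambda>x. I x * w k x)" if "prob_on_nonneg R" for R k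
  proof -
    have [simp]: "sets R = sets borel" using that by (simp add: prob_on_nonneg_def real_distribution_def real_distribution_axioms_def)
    show ?thesis
      unfolding I_def using w_int[OF that] integrable_real_mult_indicator[of "{0..D}" R "w k"]
      by (simp add: mult.commute)
  qed
  have tail: "(\<lambda>n. \<integral>x. w j x - I x * w j x \<partial>Q n) \<longlonglongrightarrow> 0" for j
  proof (rule tendstoI)
    fix e :: real assume "e > 0"
    have "(\<lambda>m. d ^ j * (1 / 2) ^ m) \<longlonglongrightarrow> d ^ j * 0"
      by (intro tendsto_intros LIMSEQ_realpow_zero) auto
    hence "\<forall>\<^sub>F m in sequentially. d ^ j * (1 / 2) ^ m < e"
      using \<open>e > 0\<close> by (intro order_tendstoD(2)) auto
    then obtain m where m: "d ^ j * (1 / 2) ^ m < e"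
      using eventually_happens'[OF sequentially_bot] by blast
    have "(\<lambda>n. (\<integral>x. w (j + m) x \<partial>Q n) / D ^ m) \<longlonglongrightarrow> (\<integral>x. w (j + m) x \<partial>P) / D ^ m"
      using D by (intro tendsto_intros w_lim) auto
    moreover have "(\<integral>x. w (j + m) x \<partial>P) / D ^ m < e"
    proof -
      have "(\<integral>x. w (j + m) x \<partial>P) / D ^ m \<le> d ^ (j + m) / D ^ m"
        using D by (intro divide_right_mono w_P) auto
      also have "\<dots> = d ^ j * (1 / 2) ^ m"
        using \<open>d > 0\<close> by (simp add: D_def power_add power_mult_distrib power_divide)
      finally show ?thesis using m by simp
    qed
    ultimately have "\<forall>\<^sub>F n in sequentially. (\<integral>x. w (j + m) x \<partial>Q n) / D ^ m < e"
      by (rule order_tendstoD(2))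
    thus "\<forall>\<^sub>F n in sequentially. dist (\<integral>x. w j x - I x * w j x \<partial>Q n) 0 < e"
    proof eventually_elim
      case (elim n)
      have "(\<integral>x. w j x - I x * w j x \<partial>Q n) \<le> (\<integral>x. w (j + m) x / D ^ m \<partial>Q n)"
      proof (rule integral_mono_AE)
        show "AE x in Q n. w j x - I x * w j x \<le> w (j + m) x / D ^ m"
          using AE_Q
        proof eventually_elim
          case (elim x)
          have "w j x - I x * w j x = indicator {D<..} x * (x ^ j * exp (- x))"
            using elim by (auto simp: I_def w_def indicator_def)
          also have "\<dots> \<le> w (j + m) x / D ^ m"
            unfolding w_def by (rule weight_moment_bound[OF elim D(1)])
          finally show ?case .
        qed
      qed (auto intro!: w_int Iw_int Q)
      moreover have "(\<integral>x. w j x - I x * w j x \<partial>Q n) \<ge> 0"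
      proof (rule integral_nonneg_AE)
        show "AE x in Q n. 0 \<le> w j x - I x * w j x"
          using AE_Q by eventually_elim (auto simp: I_def w_def indicator_def)
      qed
      ultimately show ?case using elim by simp
    qed
  qed
  have Iw_P: "(\<integral>x. I x * w j x \<partial>P) = (\<integral>x. w j x \<partial>P)" for j
  proof (rule integral_cong_AE)
    show "AE x in P. I x * w j x = w j x"
      using AE_P by eventually_elim (use D in \<open>auto simp: I_def\<close>)
  qed (simp_all cong: measurable_cong_sets)
  have Iw_lim: "(\<lambda>n. \<integral>x. I x * w j x \<partial>Q n) \<longlonglongrightarrow> (\<integral>x. I x * w j x \<partial>P)" for j
  proof -
    have diff: "(\<integral>x. w j x - I x * w j x \<partial>Q n) = (\<integral>x. w j x \<partial>Q n) - (\<integral>x. I x * w j x \<partial>Q n)" for n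
      by (intro Bochner_Integration.integral_diff w_int Iw_int Q)
    from tendsto_diff[OF w_lim[of j] tail[of j]] show ?thesis by (simp add: diff Iw_P)
  qed
  have Ig_int: "integrable R (\<lambda>x. I x * g x)"
    if R: "prob_on_nonneg R" and g: "\<And>x. isCont g x" for R and g :: "real \<Rightarrow> real"
  proof -
    interpret R: real_distribution R using R by (simp add: prob_on_nonneg_def)
    have "continuous_on {0..D} g" using g by (intro continuous_at_imp_continuous_on) auto
    hence "compact (g ` {0..D})" by (intro compact_continuous_image) auto
    then obtain B where B: "\<And>x. x \<in> {0..D} \<Longrightarrow> \<bar>g x\<bar> \<le> B"
      using compact_imp_bounded bounded_real by (metis (no_types) imageI)
    have "0 \<le> B" using B[of 0] D by auto
    have [measurable]: "g \<in> borel_measurable borel"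
      using g by (intro borel_measurable_continuous_onI continuous_at_imp_continuous_on) auto
    show ?thesis
      by (rule R.integrable_const_bound[where B = B])
         (use B \<open>0 \<le> B\<close> in \<open>auto simp: I_def indicator_def\<close>)
  qed
  have Ig_lim: "(\<lambda>n. \<integral>x. I x * g x \<partial>Q n) \<longlonglongrightarrow> (\<integral>x. I x * g x \<partial>P)"
    if g: "\<And>x. isCont g x" for g :: "real \<Rightarrow> real"
  proof (rule tendstoI)
    fix e :: real assume "e > 0"
    \<comment> \<open>Approximating \<open>g x * exp x\<close> by a polynomial turns the approximant
      of \<open>g\<close> into a combination of the \<open>w i\<close>. On \<open>{0..D}\<close> the
      factor \<open>exp (- x) \<le> 1\<close> does not enlarge the error.\<close>
    have "continuous_on {0..D} (\<lambda>x. g x * exp x)"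
      using g by (intro continuous_intros continuous_at_imp_continuous_on) auto
    then obtain h where h: "real_polynomial_function h"
      "\<And>x. x \<in> {0..D} \<Longrightarrow> \<bar>g x * exp x - h x\<bar> < e / 3"
      using Stone_Weierstrass_real_polynomial_function[of "{0..D}" "\<lambda>x. g x * exp x" "e / 3"] \<open>e > 0\<close>
      by auto
    obtain a N where a: "h = (\<lambda>x. \<Sum>i\<le>N. a i * x ^ i)"
      using h(1) real_polynomial_function_iff_sum by auto
    define v where "v = (\<lambda>x. \<Sum>i\<le>N. a i * (I x * w i x))"
    have v_int: "integrable R v" if "prob_on_nonneg R" for R
      unfolding v_def by (intro Bochner_Integration.integrable_sum integrable_mult_right Iw_int that)
    have v_eq: "(\<integral>x. v x \<partial>R) = (\<Sum>i\<le>N. a i * (\<integral>x. I x * w i x \<partial>R))" if "prob_on_nonneg R" for R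
      unfolding v_def
      by (subst Bochner_Integration.integral_sum) (auto intro!: integrable_mult_right Iw_int that)
    have v_lim: "(\<lambda>n. \<integral>x. v x \<partial>Q n) \<longlonglongrightarrow> (\<integral>x. v x \<partial>P)"
      unfolding v_eq[OF Q] v_eq[OF P] by (intro tendsto_intros Iw_lim)
    have approx: "\<bar>(\<integral>x. I x * g x \<partial>R) - (\<integral>x. v x \<partial>R)\<bar> \<le> e / 3" if R: "prob_on_nonneg R" for R
    proof -
      interpret R: real_distribution R using R by (simp add: prob_on_nonneg_def)
      have bound: "\<bar>I x * g x - v x\<bar> \<le> e / 3" for x
      proof (cases "x \<in> {0..D}")
        case True
        have "v x = h x * exp (- x)"
          using True by (simp add: v_def a I_def w_def sum_distrib_right mult.assoc)
        hence "I x * g x - v x = (g x * exp x - h x) * exp (- x)"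
          using True by (simp add: I_def left_diff_distrib mult.assoc flip: exp_add)
        also have "\<bar>\<dots>\<bar> \<le> e / 3 * 1"
          unfolding abs_mult using h(2)[OF True] True \<open>e > 0\<close> by (intro mult_mono) auto
        finally show ?thesis by simp
      next
        case False
        hence "I x = 0" by (simp add: I_def)
        thus ?thesis using \<open>e > 0\<close> by (simp add: v_def)
      qed
      have "(\<integral>x. I x * g x \<partial>R) - (\<integral>x. v x \<partial>R) = (\<integral>x. I x * g x - v x \<partial>R)"
        by (intro Bochner_Integration.integral_diff[symmetric] Ig_int R g v_int)
      also have "\<bar>\<dots>\<bar> \<le> (\<integral>x. \<bar>I x * g x - v x\<bar> \<partial>R)"
        by (rule integral_abs_bound)
      also have "\<dots> \<le> (\<integral>x. e / 3 \<partial>R)"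
        using bound
        by (intro integral_mono integrable_abs Bochner_Integration.integrable_diff Ig_int R g v_int) auto
      finally show ?thesis by (simp add: R.prob_space[unfolded R.space_eq_univ])
    qed
    have "\<forall>\<^sub>F n in sequentially. dist (\<integral>x. v x \<partial>Q n) (\<integral>x. v x \<partial>P) < e / 3"
      using v_lim \<open>e > 0\<close> by (intro tendstoD) auto
    thus "\<forall>\<^sub>F n in sequentially. dist (\<integral>x. I x * g x \<partial>Q n) (\<integral>x. I x * g x \<partial>P) < e"
    proof eventually_elim
      case (elim n)
      thus ?case using approx[OF Q, of n] approx[OF P] unfolding dist_real_def by linarith
    qed
  qed
  have "(\<lambda>n. (\<integral>x. g x \<partial>Q n)) \<longlonglongrightarrow> (\<integral>x. g x \<partial>P)"
    if g: "\<And>x. isCont g x" "\<And>x. \<bar>g x\<bar> \<le> 1" for g :: "real \<Rightarrow> real"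
  proof -
    have [measurable]: "g \<in> borel_measurable borel"
      using g by (intro borel_measurable_continuous_onI continuous_at_imp_continuous_on) auto
    have g_int: "integrable (Q n) g" for n
      by (rule Q.integrable_const_bound[where B = 1]) (use g in auto)
    have I_int: "integrable (Q n) I" for n
      using Ig_int[OF Q, of "\<lambda>_. 1"] by simp
    have I_P: "(\<integral>x. I x * f x \<partial>P) = (\<integral>x. f x \<partial>P)"
      if [measurable]: "f \<in> borel_measurable borel" for f :: "real \<Rightarrow> real"
    proof (rule integral_cong_AE)
      show "AE x in P. I x * f x = f x"
        using AE_P by eventually_elim (use D in \<open>auto simp: I_def\<close>)
    qed (simp_all cong: measurable_cong_sets)
    \<comment> \<open>The case \<open>g = 1\<close> shows that no mass escapes from
      \<open>{0..D}\<close>; for \<open>\<bar>g\<bar> \<le> 1\<close> the truncation error is at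
      most the escaping mass.\<close>
    have "(\<lambda>n. \<integral>x. I x \<partial>Q n) \<longlonglongrightarrow> 1"
      using Ig_lim[of "\<lambda>_. 1"] I_P[of "\<lambda>_. 1"] by (simp add: P.prob_space[unfolded P.space_eq_univ])
    from tendsto_diff[OF tendsto_const this, of 1]
    have I_lim: "(\<lambda>n. 1 - (\<integral>x. I x \<partial>Q n)) \<longlonglongrightarrow> 0" by simp
    have "(\<lambda>n. (\<integral>x. g x \<partial>Q n) - (\<integral>x. I x * g x \<partial>Q n)) \<longlonglongrightarrow> 0"
    proof (rule Lim_null_comparison[OF always_eventually I_lim], rule allI)
      fix n
      have "(\<integral>x. g x \<partial>Q n) - (\<integral>x. I x * g x \<partial>Q n) = (\<integral>x. g x - I x * g x \<partial>Q n)"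
        by (intro Bochner_Integration.integral_diff[symmetric] g_int Ig_int Q g)
      also have "norm \<dots> \<le> (\<integral>x. \<bar>g x - I x * g x\<bar> \<partial>Q n)"
        unfolding real_norm_def by (rule integral_abs_bound)
      also have "\<dots> \<le> (\<integral>x. 1 - I x \<partial>Q n)"
      proof (rule integral_mono)
        show "\<bar>g x - I x * g x\<bar> \<le> 1 - I x" for x
          using g(2)[of x] by (auto simp: I_def indicator_def)
      qed (auto intro!: g_int Ig_int I_int Q g)
      also have "\<dots> = 1 - (\<integral>x. I x \<partial>Q n)"
        using I_int by (simp add: Q.prob_space[unfolded Q.space_eq_univ])
      finally show "norm ((\<integral>x. g x \<partial>Q n) - (\<integral>x. I x * g x \<partial>Q n)) \<le> 1 - (\<integral>x. I x \<partial>Q n)" .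
    qed
    from tendsto_add[OF this Ig_lim[OF g(1)]] show ?thesis by (simp add: I_P)
  qed
  thus ?thesis
    by (rule integral_bdd_continuous_conv_imp_weak_conv[OF Q.real_distribution_axioms P.real_distribution_axioms])
qed

section \<open>Reduction to a fixed sample sequence and conclusion\<close>

theorem theorem3:
  fixes M :: "'w measure"
    and A :: "nat \<Rightarrow> 'a set"
    and p :: "nat \<Rightarrow> 'a pmf"
    and P :: "real measure"
    and X :: "nat \<Rightarrow> nat \<Rightarrow> 'w \<Rightarrow> 'a"
    and P_ML :: "nat \<Rightarrow> 'w \<Rightarrow> real measure"
  assumes "prob_space M"
    and "rare_events_source A p P"
    and "iid_samples M p X"
    and "\<And>n \<omega>. n \<ge> 1 \<Longrightarrow> \<omega> \<in> space M \<Longrightarrow>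
           is_mixing_MLE (good_turing (A n) n (\<lambda>i. X n i \<omega>)) (P_ML n \<omega>)"
  shows "AE \<omega> in M. weak_conv_m (\<lambda>n. P_ML n \<omega>) P"
proof -
  interpret prob_space M by fact
  interpret P: real_distribution P
    using assms(2) by (simp add: rare_events_source_def)
  obtain c d where cd: "0 < c" "c \<le> d" and supp: "measure P {c..d} = 1"
    using rare_events_source_limit[OF assms(2)] by metis
  have supp': "measure P S = 1" if "{c..d} \<subseteq> S" "S \<in> sets borel" for S
    using P.finite_measure_mono[OF that(1)] supp that(2) P.prob_le_1[of S] by simp
  have P: "prob_on_nonneg P"
    using supp'[of "{0..}"] cd by (auto simp: prob_on_nonneg_def P.real_distribution_axioms)
  have pos: "poisson_mixture P k > 0" for k
    by (rule poisson_mixture_pos[OF P cd(1) supp])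
  have fin: "finite (A n)" if "n \<ge> 1" for n
    using assms(2) that by (simp add: rare_events_source_def)
  \<comment> \<open>One null set serves all \<open>k\<close>; outside it the rest of the argument is
    deterministic.\<close>
  have "AE \<omega> in M. \<forall>k. (\<lambda>n. good_turing (A n) n (\<lambda>i. X n i \<omega>) k) \<longlonglongrightarrow> poisson_mixture P k"
    unfolding AE_all_countable by (intro allI AE_good_turing_tendsto[OF assms(2,3)])
  moreover have "AE \<omega> in M. \<omega> \<in> space M" by simp
  ultimately show ?thesis
  proof eventually_elim
    case (elim \<omega>)
    define \<phi> where "\<phi> = (\<lambda>n. good_turing (A n) n (\<lambda>i. X n i \<omega>))"
    \<comment> \<open>The maximizers are given from \<open>n = 1\<close> on; \<open>P\<close> fills
      index 0, so that every \<open>Q n\<close> is a probability measure on the half-line.\<close>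
    define Q where "Q = (\<lambda>n. if n = 0 then P else P_ML n \<omega>)"
    have MLE: "is_mixing_MLE (\<phi> n) (Q n)" if "n \<ge> 1" for n
      using assms(4)[OF that elim(2)] that by (simp add: \<phi>_def Q_def)
    have Q: "prob_on_nonneg (Q n)" for n
      using MLE[of n] P by (cases "n = 0") (auto simp: Q_def is_mixing_MLE_def is_arg_max_def)
    have \<phi>: "\<phi> n k \<ge> 0" "k \<ge> n \<Longrightarrow> \<phi> n k = 0" for n k
      by (simp_all add: \<phi>_def good_turing_nonneg good_turing_eq_0)
    have "(\<lambda>n. poisson_mixture (Q n) k) \<longlonglongrightarrow> poisson_mixture P k" for k
    proof (rule tendsto_of_gradient[where \<phi> = \<phi>])
      fix n K assume n: "(n :: nat) \<ge> 1"
      let ?s = "\<lambda>k. \<phi> n k * poisson_mixture P k / poisson_mixture (Q n) k"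
      note gradient = mixing_MLE_gradient[OF MLE[OF n] P pos \<phi>(2) \<phi>(1)]
      show "poisson_mixture (Q n) k > 0" if "\<phi> n k > 0" for k
        by (rule gradient(1)[OF _ that])
      \<comment> \<open>The gradient inequality concerns the range \<open>k < n\<close>. Nonnegative
        terms allow enlarging \<open>K\<close>, and those with \<open>k \<ge> n\<close>
        vanish.\<close>
      have "sum ?s {..<K} \<le> sum ?s {..<max n K}"
        using \<phi>(1) poisson_mixture_nonneg[OF P] poisson_mixture_nonneg[OF Q]
        by (intro sum_mono2) auto
      also have "\<dots> = sum ?s {..<n}"
        by (rule sum.mono_neutral_right) (auto simp: \<phi>(2))
      also have "\<dots> \<le> (\<Sum>k<n. \<phi> n k)"
        by (rule gradient(2))
      also have "\<dots> \<le> 1"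
        unfolding \<phi>_def by (rule sum_good_turing_le_1[OF fin[OF n]])
      finally show "sum ?s {..<K} \<le> 1" .
    qed (use elim(1) in \<open>simp_all add: \<phi>(1) P Q poisson_mixture_nonneg poisson_mixture_le_1
        sum_poisson_mixture_le_1 poisson_mixture_sums \<phi>_def good_turing_nonneg\<close>)
    hence "weak_conv_m Q P"
      using cd by (intro weak_conv_m_of_poisson_mixture[OF Q P, of d] supp') auto
    moreover have "\<forall>\<^sub>F n in sequentially. Q n = P_ML n \<omega>"
      using eventually_ge_at_top[of 1] by eventually_elim (simp add: Q_def)
    ultimately show "weak_conv_m (\<lambda>n. P_ML n \<omega>) P"
      unfolding weak_conv_m_def weak_conv_def
      by (auto elim!: Lim_transform_eventually eventually_mono)
  qed
qed

end
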